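(* Let $d=3$ and let $\{S_k,k\ge 0\}$ be the nearest-neighbor symmetric (simple) random walk on $\mathbb{Z}^3$ started at $0$ under $P_0$. Let $\{r_n\}$ be a sequence of positive reals going to infinity with $r_n^3=O(n)$. Then, when $\epsilon_0>0$ and $\delta_0>0$ are small enough, $$\lim_{n\to\infty} P_0\left(\left|\left\{x\in\mathbb{Z}^3:\ l_n(x)>\delta_0\frac{n}{|B(r_n)|}\right\}\right|\ge \epsilon_0|B(r_n)|\ \Big|\ \sigma(r_n)>n\right)=1.$$
   Context: $l_n(x)=\sum_{k=0}^n 1\{S_k=x\}$ is the number of visits of the walk to $x$ up to time $n$. $B(r)$ is the ball of radius $r$ in $\mathbb{Z}^3$ centered at the origin, $\sigma(r)$ is the first time the walk exits $B(r)$, and $|\Lambda|$ denotes the cardinality of a finite set $\Lambda$. The notation $r_n^3=O(n)$ means that there is a constant $A>0$ with $r_n^3\le An$ for all $n$. *)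

theory Defs
  imports "HOL-Probability.Probability"
begin

definition unit_steps :: "(int ^ 'd) set" where
  "unit_steps = {axis i s | i s. s \<in> {-1, 1}}"

locale simple_random_walk = prob_space M
  for M :: "'w measure" and S :: "nat \<Rightarrow> 'w \<Rightarrow> int ^ 'd" +
  assumes random_variable_walk: "\<And>k. random_variable (count_space UNIV) (S k)"
    and start_at_origin: "\<And>\<omega>. \<omega> \<in> space M \<Longrightarrow> S 0 \<omega> = 0"
    and indep_increments:
      "indep_vars (\<lambda>_. count_space UNIV) (\<lambda>k \<omega>. S (Suc k) \<omega> - S k \<omega>) UNIV"
    and distr_increment:
      "\<And>k. distr M (count_space UNIV) (\<lambda>\<omega>. S (Suc k) \<omega> - S k \<omega>)
             = measure_pmf (pmf_of_set unit_steps)"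

definition lattice_ball :: "real \<Rightarrow> (int ^ 'd) set" where
  "lattice_ball r = {x. norm (\<chi> i. real_of_int (x $ i)) \<le> r}"

definition local_time :: "(nat \<Rightarrow> 'w \<Rightarrow> int ^ 'd) \<Rightarrow> nat \<Rightarrow> int ^ 'd \<Rightarrow> 'w \<Rightarrow> nat" where
  "local_time S n x \<omega> = (\<Sum>k=0..n. of_bool (S k \<omega> = x))"

(* The infimum of the empty set is \<infinity>: the exit time of a path that never leaves the ball. *)
definition exit_time :: "(nat \<Rightarrow> 'w \<Rightarrow> int ^ 'd) \<Rightarrow> real \<Rightarrow> 'w \<Rightarrow> enat" where
  "exit_time S r \<omega> = Inf {enat k | k. S k \<omega> \<notin> lattice_ball r}"

end

theory Submission
  imports Defs
begin

text \<open>
  Call a site heavy if its local time exceeds \<open>\<theta> = \<delta>\<^sub>0 n / |B(r)|\<close>. On the exceptional event the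
  walk stays in the ball \<open>B(r)\<close> although fewer than \<open>\<epsilon>\<^sub>0 |B(r)|\<close> sites are heavy. Since the sites
  that are not heavy absorb at most \<open>\<delta>\<^sub>0 n\<close> units of time, almost all the time is then spent in a
  set of small volume. Conditioning on confinement costs only a factor \<open>exp (C n / r\<^sup>2)\<close>, so it
  suffices that the exceptional event has probability at most \<open>exp (- C' n / r\<^sup>2)\<close> with \<open>C' > C\<close>,
  which holds once \<open>\<epsilon>\<^sub>0\<close> is small, with \<open>\<delta>\<^sub>0 < 1/16\<close>.

  The set of heavy sites depends on the whole path, and a union bound over its possible values
  would cost \<open>exp (c r\<^sup>3)\<close>, which is far too much when \<open>n\<close> is of order \<open>r\<^sup>3\<close>. Instead, time is cut
  into blocks of length \<open>L\<close> of order \<open>r\<^sup>2\<close>, and a block is compared only with the set of sites that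
  were already heavy when it began; given the past, this set is deterministic. A block is bad if it
  spends a quarter of its time in that set (which matters only while the set has volume at most
  \<open>\<epsilon>\<^sub>0 |B(r)|\<close>), or if it spends a quarter of its time at sites that it visits more than \<open>m\<close>
  times itself. By the bound \<open>C k\<^sup>-\<^sup>3\<^sup>/\<^sup>2\<close> for the transition probabilities (\<open>heat_kernel_bound\<close>), both have
  small probability whatever the past was (\<open>bad_block_mean_le\<close>): the first because a set of volume
  \<open>\<epsilon> r\<^sup>3\<close> holds the walk at most for a time of order \<open>\<epsilon>\<^sup>1\<^sup>/\<^sup>3 r\<^sup>2\<close>, the second because in dimension three the
  expected number of self-intersections of a block is of order \<open>L\<close>. Hence the number of bad blocks
  has small exponential moments, and a quarter of the blocks being bad is as unlikely as required
  (\<open>many_bad_blocks_le\<close>).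

  The other blocks give the contradiction (\<open>occupation_le_of_few_bad_blocks\<close>). They spend half of
  their time at sites that are not yet heavy and that the block visits at most \<open>m\<close> times. A site
  can collect at most \<open>\<theta> + m\<close> such visits: look at the last block that contributes one. All earlier
  visits happened while the site was not yet heavy, and this block adds at most \<open>m\<close>. Sites that
  never become heavy collect at most \<open>\<theta>\<close>. The total is at most
  \<open>\<theta> |B(r)| + m \<epsilon>\<^sub>0 |B(r)| \<le> \<delta>\<^sub>0 n + C m \<epsilon>\<^sub>0 r\<^sup>3\<close>, and this is where \<open>r\<^sup>3 = O(n)\<close> enters.

  The lower bound for the confinement probability (\<open>stay_in_ball_ge\<close>) comes from a product of
  cosines, which is an eigenfunction of the walk killed outside a cube.
\<close>

section \<open>Convolutions of binomial coefficients with inverse powers\<close>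

text \<open>
  Number of nearest-neighbour paths of length \<open>n\<close> in \<open>\<int>\<close> from \<open>0\<close> to \<open>z\<close>.
\<close>
fun line_paths :: "nat \<Rightarrow> int \<Rightarrow> nat" where
  "line_paths 0 z = of_bool (z = 0)"
| "line_paths (Suc n) z = line_paths n (z - 1) + line_paths n (z + 1)"

lemma line_paths_eq_0:
  assumes "\<And>k::nat. z \<noteq> 2 * int k - int n"
  shows "line_paths n z = 0"
  using assms
proof (induction n arbitrary: z)
  case 0
  from 0[of 0] show ?case by simp
next
  case (Suc n)
  have "z - 1 \<noteq> 2 * int k - int n" for k
    using Suc.prems[of "Suc k"] by auto
  moreover have "z + 1 \<noteq> 2 * int k - int n" for k
    using Suc.prems[of k] by auto
  ultimately show ?case using Suc.IH by simp
qed

lemma line_paths_eq_binomial: "line_paths n (2 * int k - int n) = n choose k"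
proof (induction n arbitrary: k)
  case 0
  then show ?case by (cases k) auto
next
  case (Suc n)
  show ?case
  proof (cases k)
    case 0
    have "line_paths n (- int n - 2) = 0"
      by (rule line_paths_eq_0) auto
    with 0 Suc.IH[of 0] show ?thesis by (simp add: algebra_simps)
  next
    case k: (Suc l)
    have shifts: "2 * int k - int (Suc n) - 1 = 2 * int l - int n"
      "2 * int k - int (Suc n) + 1 = 2 * int k - int n" using k by auto
    show ?thesis unfolding line_paths.simps shifts Suc.IH using k by simp
  qed
qed

text \<open>
  The square of the left-hand side grows in each step by the factor
  \<open>16 (m + 1/2) (m + 3/2) / (m + 1)\<^sup>2 \<le> 16\<close>.
\<close>
lemma central_binomial_sqrt_bound: "real ((2 * m) choose m) * sqrt (real (2 * m + 1)) \<le> 4 ^ m"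
proof -
  have "real ((2 * m) choose m) ^ 2 * real (2 * m + 1) \<le> 16 ^ m"
  proof (induction m)
    case 0
    then show ?case by simp
  next
    case (Suc m)
    have eq: "real ((2 * Suc m) choose Suc m) * real (m + 1) = real ((2 * m) choose m) * (2 * (2 * real m + 1))"
    proof -
      have "Suc m * ((2 * Suc m) choose Suc m) = (2 * Suc m) * (Suc (2 * m) choose m)"
        using Suc_times_binomial_eq[of "Suc (2 * m)" m] by (simp add: mult.commute)
      moreover have "Suc m * (Suc (2 * m) choose m) = Suc (2 * m) * ((2 * m) choose m)"
        using binomial_absorb_comp[of "Suc (2 * m)" m] by (simp add: mult.commute)
      ultimately have "Suc m * (Suc m * ((2 * Suc m) choose Suc m)) = Suc m * (2 * Suc (2 * m) * ((2 * m) choose m))"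
        by (metis (no_types, lifting) mult.assoc mult.left_commute)
      then have "Suc m * ((2 * Suc m) choose Suc m) = 2 * Suc (2 * m) * ((2 * m) choose m)"
        by (simp only: mult_cancel1 nat.simps simp_thms)
      then have "real (Suc m * ((2 * Suc m) choose Suc m)) = real (2 * Suc (2 * m) * ((2 * m) choose m))"
        by (rule arg_cong)
      then show ?thesis by (simp add: algebra_simps del: binomial_Suc_Suc)
    qed
    define A where "A = real ((2 * m) choose m)"
    define B where "B = real ((2 * Suc m) choose Suc m)"
    define x where "x = real m"
    have x: "x \<ge> 0" by (simp add: x_def)
    have B: "B * (x + 1) = A * (2 * (2 * x + 1))" using eq by (simp add: A_def B_def x_def add.commute del: binomial_Suc_Suc)
    have IH: "A\<^sup>2 * (2 * x + 1) \<le> 16 ^ m" using Suc by (simp add: A_def x_def algebra_simps)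
    have "(B\<^sup>2 * (2 * x + 3)) * (x + 1)\<^sup>2 = (B * (x + 1))\<^sup>2 * (2 * x + 3)" by (simp add: power_mult_distrib)
    also have "\<dots> = (A\<^sup>2 * (2 * x + 1)) * (4 * ((2 * x + 1) * (2 * x + 3)))"
      unfolding B by (simp add: power2_eq_square algebra_simps)
    also have "\<dots> \<le> 16 ^ m * (4 * ((2 * x + 1) * (2 * x + 3)))"
      using IH x by (intro mult_right_mono) auto
    also have "\<dots> \<le> 16 ^ m * (16 * (x + 1)\<^sup>2)"
      by (intro mult_left_mono) (auto simp: power2_eq_square algebra_simps)
    finally have "(B\<^sup>2 * (2 * x + 3)) * (x + 1)\<^sup>2 \<le> 16 ^ Suc m * (x + 1)\<^sup>2" by (simp add: algebra_simps)
    then have "B\<^sup>2 * (2 * x + 3) \<le> 16 ^ Suc m" using x by (simp add: mult_le_cancel_right)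
    then show ?case by (simp add: B_def x_def algebra_simps)
  qed
  then have "sqrt (real ((2 * m) choose m) ^ 2 * real (2 * m + 1)) \<le> sqrt ((4 ^ m)\<^sup>2)"
    by (subst real_sqrt_le_iff) (simp add: power2_eq_square flip: power_mult_distrib)
  then show ?thesis by (simp add: real_sqrt_mult)
qed

lemma binomial_sqrt_bound: "real (n choose k) * sqrt (real (n + 1)) \<le> 2 ^ n"
proof -
  have mid: "real (n choose (n div 2)) * sqrt (real (n + 1)) \<le> 2 ^ n"
  proof (cases "even n")
    case True
    then obtain m where n: "n = 2 * m" by blast
    show ?thesis using central_binomial_sqrt_bound[of m] by (simp add: n power_mult)
  next
    case False
    then obtain m where n: "n = 2 * m + 1" by (metis oddE)
    have "2 * (n choose m) = (2 * Suc m) choose (Suc m)"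
      using binomial_symmetric[of "Suc m" "Suc (2 * m)"] n by (simp add: numeral_2_eq_2)
    then have "2 * real (n choose m) = real ((2 * Suc m) choose (Suc m))"
      by (metis of_nat_mult of_nat_numeral)
    moreover have "sqrt (real (n + 1)) \<le> sqrt (real (2 * Suc m + 1))" using n by simp
    ultimately have "2 * real (n choose m) * sqrt (real (n + 1)) \<le> 4 ^ Suc m"
      using central_binomial_sqrt_bound[of "Suc m"]
      by (metis mult_left_mono of_nat_0_le_iff order_trans)
    then show ?thesis using n by (simp add: power_mult)
  qed
  have "real (n choose k) * sqrt (real (n + 1)) \<le> real (n choose (n div 2)) * sqrt (real (n + 1))"
    by (intro mult_right_mono) (auto simp: binomial_maximum)
  with mid show ?thesis by linarith
qed

lemma line_paths_bound: "real (line_paths n z) \<le> 2 ^ n / sqrt (real (n + 1))"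
proof -
  have "real (line_paths n z) * sqrt (real (n + 1)) \<le> 2 ^ n"
  proof (cases "\<exists>k::nat. z = 2 * int k - int n")
    case True
    then obtain k :: nat where "z = 2 * int k - int n" by blast
    then show ?thesis using binomial_sqrt_bound[of n k] by (simp only: line_paths_eq_binomial)
  next
    case False
    then show ?thesis using line_paths_eq_0[of z n] by simp
  qed
  then show ?thesis by (simp add: pos_le_divide_eq)
qed

text \<open>
  A path in a product of lattices is an interleaving of its coordinate paths, so the numbers of paths
  combine by this convolution, whose exponential generating function is the product.
\<close>
definition binomial_convolution :: "(nat \<Rightarrow> real) \<Rightarrow> (nat \<Rightarrow> real) \<Rightarrow> nat \<Rightarrow> real" where
  "binomial_convolution f g k = (\<Sum>i\<le>k. real (k choose i) * f i * g (k - i))"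

text \<open>
  The Leibniz rule: one more step is taken in the first or in the second factor.
\<close>
lemma binomial_convolution_Suc:
  "binomial_convolution f g (Suc k) =
     binomial_convolution (\<lambda>i. f (Suc i)) g k + binomial_convolution f (\<lambda>i. g (Suc i)) k"
proof -
  have "binomial_convolution f g (Suc k)
      = f 0 * g (Suc k) + (\<Sum>i\<le>k. real (Suc k choose Suc i) * f (Suc i) * g (k - i))"
    unfolding binomial_convolution_def by (subst sum.atMost_Suc_shift) simp
  also have "(\<Sum>i\<le>k. real (Suc k choose Suc i) * f (Suc i) * g (k - i))
      = binomial_convolution (\<lambda>i. f (Suc i)) g k + (\<Sum>i\<le>k. real (k choose Suc i) * f (Suc i) * g (k - i))"
    by (simp add: binomial_convolution_def sum.distrib algebra_simps)
  also have "f 0 * g (Suc k) + (binomial_convolution (\<lambda>i. f (Suc i)) g k + (\<Sum>i\<le>k. real (k choose Suc i) * f (Suc i) * g (k - i)))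
      = binomial_convolution (\<lambda>i. f (Suc i)) g k
        + (f 0 * g (Suc k) + (\<Sum>i\<le>k. real (k choose Suc i) * f (Suc i) * g (k - i)))"
    by simp
  also have "f 0 * g (Suc k) + (\<Sum>i\<le>k. real (k choose Suc i) * f (Suc i) * g (k - i))
      = (\<Sum>i\<le>Suc k. real (k choose i) * f i * g (Suc k - i))"
    by (subst sum.atMost_Suc_shift) simp
  also have "(\<Sum>i\<le>Suc k. real (k choose i) * f i * g (Suc k - i)) = binomial_convolution f (\<lambda>i. g (Suc i)) k"
    by (simp add: binomial_convolution_def Suc_diff_le)
  finally show ?thesis .
qed

text \<open>
  Cauchy--Schwarz for the weights \<open>w\<close>. It replaces the inverse square roots that come from the
  coordinate walks by inverse integers, which binomial coefficients absorb exactly.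
\<close>
lemma weighted_sum_le_sqrt:
  fixes w v :: "'a \<Rightarrow> real"
  assumes "\<And>i. i \<in> I \<Longrightarrow> w i \<ge> 0"
  shows "(\<Sum>i\<in>I. w i * v i) \<le> sqrt (\<Sum>i\<in>I. w i) * sqrt (\<Sum>i\<in>I. w i * (v i)\<^sup>2)"
proof -
  have "(\<Sum>i\<in>I. w i * v i) = (\<Sum>i\<in>I. sqrt (w i) * (sqrt (w i) * v i))"
    using assms by (intro sum.cong) (auto simp flip: mult.assoc)
  also have "\<dots> \<le> sqrt ((\<Sum>i\<in>I. (sqrt (w i))\<^sup>2) * (\<Sum>i\<in>I. (sqrt (w i) * v i)\<^sup>2))"
    by (rule real_le_rsqrt[OF Cauchy_Schwarz_ineq_sum])
  also have "\<dots> = sqrt (\<Sum>i\<in>I. w i) * sqrt (\<Sum>i\<in>I. w i * (v i)\<^sup>2)"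
    using assms by (simp add: real_sqrt_mult power_mult_distrib cong: sum.cong)
  finally show ?thesis .
qed

lemma binomial_Suc_Suc_eq_times:
  assumes "i \<le> k"
  shows "real (k choose i) * (real k + 1) * (real k + 2)
           = real (Suc (Suc k) choose Suc i) * (real i + 1) * (real (k - i) + 1)"
proof -
  have 1: "Suc i * (Suc k choose Suc i) = Suc k * (k choose i)"
    by (rule Suc_times_binomial_eq[symmetric, of k i, unfolded mult.commute[of "Suc k choose Suc i"]])
  have 2: "Suc (k - i) * (Suc (Suc k) choose Suc i) = Suc (Suc k) * (Suc k choose Suc i)"
    using binomial_absorb_comp[of "Suc (Suc k)" "Suc i"] assms by (simp add: Suc_diff_le)
  have "real (Suc i) * real (Suc k choose Suc i) = real (Suc k) * real (k choose i)"
    using 1 by (metis of_nat_mult)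
  moreover have "real (Suc (k - i)) * real (Suc (Suc k) choose Suc i) = real (Suc (Suc k)) * real (Suc k choose Suc i)"
    using 2 by (metis of_nat_mult)
  ultimately have "real (Suc k) * real (k choose i) * real (Suc (Suc k))
      = real (Suc i) * (real (Suc (k - i)) * real (Suc (Suc k) choose Suc i))"
    by (metis (no_types, opaque_lifting) mult.assoc mult.commute)
  then show ?thesis by (simp add: algebra_simps)
qed

lemma sum_binomial_shift_le:
  fixes c :: real
  assumes "c \<ge> 0" "j \<ge> 1"
  shows "(\<Sum>i\<le>k. real ((k + j) choose (i + 1)) * c ^ (k + j - (i + 1))) \<le> (1 + c) ^ (k + j)"
proof -
  have "(\<Sum>i\<le>k. real ((k + j) choose (i + 1)) * c ^ (k + j - (i + 1)))
      = (\<Sum>i\<in>Suc ` {..k}. real ((k + j) choose i) * c ^ (k + j - i))"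
    by (subst sum.reindex) auto
  also have "\<dots> \<le> (\<Sum>i\<le>k + j. real ((k + j) choose i) * c ^ (k + j - i))"
    using assms by (intro sum_mono2) auto
  also have "\<dots> = (1 + c) ^ (k + j)"
    using binomial_ring[of 1 c "k + j"] by simp
  finally show ?thesis .
qed

lemma sum_binomial_power:
  "(\<Sum>i\<le>k. real (k choose i) * c ^ (k - i)) = (1 + c) ^ k" for c :: real
  using binomial_ring[of 1 c k] by simp

text \<open>
  The weights \<open>k choose i\<close> have sum \<open>2 ^ k\<close>, and dividing them by \<open>(i + 1) (k - i + 1)\<close> gives
  \<open>(k + 2) choose (i + 1)\<close> up to the factor \<open>1 / ((k + 1) (k + 2))\<close>.
\<close>
lemma plane_convolution_bound:
  assumes f: "\<And>i. 0 \<le> f i \<and> f i \<le> 2 ^ i / sqrt (real (i + 1))"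
    and g: "\<And>i. 0 \<le> g i \<and> g i \<le> 2 ^ i / sqrt (real (i + 1))"
  shows "binomial_convolution f g k \<le> 2 * 4 ^ k / (real k + 1)"
proof -
  define v where "v i = 1 / (sqrt (real i + 1) * sqrt (real (k - i) + 1))" for i
  have v2: "real (k choose i) * (v i)\<^sup>2 = real ((k + 2) choose (i + 1)) * 1 ^ (k + 2 - (i + 1)) / ((real k + 1) * (real k + 2))"
    if "i \<le> k" for i
    using binomial_Suc_Suc_eq_times[OF that]
    by (simp add: v_def power_divide power_mult_distrib divide_simps)
  have "binomial_convolution f g k \<le> (\<Sum>i\<le>k. 2 ^ k * (real (k choose i) * v i))"
    unfolding binomial_convolution_def
  proof (rule sum_mono)
    fix i assume "i \<in> {..k}"
    then have i: "i \<le> k" by simp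
    have "f i * g (k - i) \<le> (2 ^ i / sqrt (real (i + 1))) * (2 ^ (k - i) / sqrt (real (k - i + 1)))"
      using f g by (intro mult_mono) auto
    also have "\<dots> = 2 ^ k * v i" using i by (simp add: v_def add.commute flip: power_add)
    finally show "real (k choose i) * f i * g (k - i) \<le> 2 ^ k * (real (k choose i) * v i)"
      using mult_left_mono[of "f i * g (k - i)" "2 ^ k * v i" "real (k choose i)"] by (simp add: algebra_simps)
  qed
  also have "\<dots> = 2 ^ k * (\<Sum>i\<le>k. real (k choose i) * v i)" by (simp add: sum_distrib_left)
  also have "(\<Sum>i\<le>k. real (k choose i) * v i) \<le> sqrt (\<Sum>i\<le>k. real (k choose i)) * sqrt (\<Sum>i\<le>k. real (k choose i) * (v i)\<^sup>2)"
    by (rule weighted_sum_le_sqrt) auto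
  also have "(\<Sum>i\<le>k. real (k choose i)) = 2 ^ k" using sum_binomial_power[of k 1] by simp
  also have "(\<Sum>i\<le>k. real (k choose i) * (v i)\<^sup>2)
      = (\<Sum>i\<le>k. real ((k + 2) choose (i + 1)) * 1 ^ (k + 2 - (i + 1))) / ((real k + 1) * (real k + 2))"
    by (simp only: sum_divide_distrib) (intro sum.cong, auto simp: v2)
  also have "sqrt (2 ^ k) * sqrt \<dots> \<le> sqrt (2 ^ k) * sqrt ((1 + 1) ^ (k + 2) / ((real k + 1) * (real k + 1)))"
    by (intro mult_left_mono real_sqrt_le_mono frac_le sum_binomial_shift_le) auto
  also have "\<dots> = sqrt (2 ^ k * 2 ^ (k + 2) / ((real k + 1) * (real k + 1)))"
    by (simp add: real_sqrt_mult real_sqrt_divide)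
  also have "2 ^ k * 2 ^ (k + 2) / ((real k + 1) * (real k + 1)) = (2 * 2 ^ k / (real k + 1))\<^sup>2"
    by (simp add: power2_eq_square power_add)
  also have "sqrt \<dots> = 2 * 2 ^ k / (real k + 1)" by simp
  also have "2 ^ k * (2 * 2 ^ k / (real k + 1)) = 2 * 4 ^ k / (real k + 1)"
    using power_mult_distrib[of "2 :: real" 2 k] by simp
  finally show ?thesis by simp
qed

text \<open>
  The step from dimension two to three, by the same argument with the weights
  \<open>(k choose i) 2 ^ (k - i)\<close> of sum \<open>3 ^ k\<close>. The factor \<open>1 / (y + 1)\<^sup>2\<close> with \<open>y = k - i\<close> is first replaced
  by \<open>2 / ((y + 1) (y + 2))\<close>, so that the coefficients become \<open>(k + 3) choose (i + 1)\<close>.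
\<close>
lemma space_convolution_bound:
  assumes f: "\<And>i. 0 \<le> f i \<and> f i \<le> 2 ^ i / sqrt (real (i + 1))"
    and g: "\<And>i. 0 \<le> g i \<and> g i \<le> 2 * 4 ^ i / (real i + 1)"
  shows "binomial_convolution f g k \<le> 8 * 6 ^ k / sqrt (real k + 1) ^ 3"
proof -
  define v where "v i = 1 / (sqrt (real i + 1) * (real (k - i) + 1))" for i
  define w where "w i = real (k choose i) * 2 ^ (k - i)" for i
  have v2: "w i * (v i)\<^sup>2 \<le> (1 / (2 * (real k + 1) ^ 3)) * (real ((k + 3) choose (i + 1)) * 2 ^ (k + 3 - (i + 1)))"
    if i: "i \<le> k" for i
  proof -
    define y where "y = real (k - i)"
    have y: "y \<ge> 0" by (simp add: y_def)
    define B where "B = real (Suc (Suc k) choose Suc i)"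
    have B: "B * (real k + 3) = real ((k + 3) choose (i + 1)) * (y + 2)"
    proof -
      have "(k + 3 - (i + 1)) * ((k + 3) choose (i + 1)) = (k + 3) * ((k + 2) choose (i + 1))"
        using binomial_absorb_comp[of "k + 3" "i + 1"] by simp
      then have "real (k + 3 - (i + 1)) * real ((k + 3) choose (i + 1)) = real (k + 3) * real ((k + 2) choose (i + 1))"
        by (metis of_nat_mult)
      moreover have "real (k + 3 - (i + 1)) = y + 2" using i by (simp add: y_def of_nat_diff)
      ultimately show ?thesis by (simp add: B_def mult.commute)
    qed
    have B': "real (k choose i) * (real k + 1) * (real k + 2) = B * (real i + 1) * (y + 1)"
      unfolding B_def y_def by (rule binomial_Suc_Suc_eq_times[OF i])
    have "real (k choose i) * (real k + 1) * (real k + 2) * (real k + 3) = (B * (real k + 3)) * (real i + 1) * (y + 1)"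
      unfolding B' by (simp only: mult_ac)
    also have "\<dots> = real ((k + 3) choose (i + 1)) * (real i + 1) * (y + 1) * (y + 2)"
      unfolding B by (simp only: mult_ac)
    finally have c: "real (k choose i) * (real k + 1) * (real k + 2) * (real k + 3)
        = real ((k + 3) choose (i + 1)) * (real i + 1) * (y + 1) * (y + 2)" .
    have "real (k choose i) * (real k + 1) ^ 3 \<le> real (k choose i) * ((real k + 1) * (real k + 2) * (real k + 3))"
      unfolding power3_eq_cube by (intro mult_left_mono mult_mono) auto
    also have "\<dots> = real ((k + 3) choose (i + 1)) * (real i + 1) * ((y + 1) * (y + 2))"
      using c by (simp only: mult.assoc)
    also have "\<dots> \<le> real ((k + 3) choose (i + 1)) * (real i + 1) * ((y + 1) * (2 * (y + 1)))"
      using y by (intro mult_left_mono) auto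
    finally have "real (k choose i) * (real k + 1) ^ 3 \<le> 2 * real ((k + 3) choose (i + 1)) * ((real i + 1) * (y + 1)\<^sup>2)"
      by (simp add: power2_eq_square algebra_simps)
    then have "real (k choose i) / ((real i + 1) * (y + 1)\<^sup>2) \<le> 2 * real ((k + 3) choose (i + 1)) / (real k + 1) ^ 3"
      using y by (simp add: divide_simps add_pos_nonneg)
    then have "2 ^ (k - i) * (real (k choose i) / ((real i + 1) * (y + 1)\<^sup>2)) \<le> 2 ^ (k - i) * (2 * real ((k + 3) choose (i + 1)) / (real k + 1) ^ 3)"
      by (intro mult_left_mono) auto
    moreover have e: "k + 3 - (i + 1) = (k - i) + 2" using i by simp
    moreover have vv: "(v i)\<^sup>2 = 1 / ((real i + 1) * (y + 1)\<^sup>2)"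
      by (simp add: v_def y_def power_mult_distrib power_divide)
    ultimately show ?thesis
      unfolding w_def vv e power_add by (simp add: mult.commute mult.left_commute)
  qed
  have "binomial_convolution f g k \<le> (\<Sum>i\<le>k. (2 * 2 ^ k) * (w i * v i))"
    unfolding binomial_convolution_def
  proof (rule sum_mono)
    fix i assume "i \<in> {..k}"
    then have i: "i \<le> k" by simp
    have "f i * g (k - i) \<le> (2 ^ i / sqrt (real (i + 1))) * (2 * 4 ^ (k - i) / (real (k - i) + 1))"
      using f g by (intro mult_mono) auto
    also have "(4::real) ^ (k - i) = 2 ^ (k - i) * 2 ^ (k - i)" by (simp flip: power_mult_distrib)
    also have "(2 ^ i / sqrt (real (i + 1))) * (2 * (2 ^ (k - i) * 2 ^ (k - i)) / (real (k - i) + 1))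
       = 2 * (2 ^ i * 2 ^ (k - i)) * (2 ^ (k - i) * v i)" by (simp add: v_def add.commute)
    also have "(2::real) ^ i * 2 ^ (k - i) = 2 ^ k" using i by (simp flip: power_add)
    finally show "real (k choose i) * f i * g (k - i) \<le> (2 * 2 ^ k) * (w i * v i)"
      using mult_left_mono[of "f i * g (k - i)" "2 * 2 ^ k * (2 ^ (k - i) * v i)" "real (k choose i)"]
      by (simp add: w_def algebra_simps)
  qed
  also have "\<dots> = (2 * 2 ^ k) * (\<Sum>i\<le>k. w i * v i)" by (simp add: sum_distrib_left)
  also have "(\<Sum>i\<le>k. w i * v i) \<le> sqrt (\<Sum>i\<le>k. w i) * sqrt (\<Sum>i\<le>k. w i * (v i)\<^sup>2)"
    by (rule weighted_sum_le_sqrt) (simp add: w_def)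
  also have "(\<Sum>i\<le>k. w i) = 3 ^ k" using sum_binomial_power[of k 2] by (simp add: w_def)
  also have "sqrt (3 ^ k) * sqrt (\<Sum>i\<le>k. w i * (v i)\<^sup>2)
      \<le> sqrt (3 ^ k) * sqrt ((1 / (2 * (real k + 1) ^ 3)) * (1 + 2) ^ (k + 3))"
  proof (intro mult_left_mono real_sqrt_le_mono)
    have "(\<Sum>i\<le>k. w i * (v i)\<^sup>2) \<le> (\<Sum>i\<le>k. (1 / (2 * (real k + 1) ^ 3)) * (real ((k + 3) choose (i + 1)) * 2 ^ (k + 3 - (i + 1))))"
      using v2 by (intro sum_mono) auto
    also have "\<dots> = (1 / (2 * (real k + 1) ^ 3)) * (\<Sum>i\<le>k. real ((k + 3) choose (i + 1)) * 2 ^ (k + 3 - (i + 1)))"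
      by (rule sum_distrib_left[symmetric])
    also have "\<dots> \<le> (1 / (2 * (real k + 1) ^ 3)) * (1 + 2) ^ (k + 3)"
      by (intro mult_left_mono sum_binomial_shift_le) auto
    finally show "(\<Sum>i\<le>k. w i * (v i)\<^sup>2) \<le> (1 / (2 * (real k + 1) ^ 3)) * (1 + 2) ^ (k + 3)" .
  qed auto
  also have "sqrt (3 ^ k) * sqrt ((1 / (2 * (real k + 1) ^ 3)) * (1 + 2) ^ (k + 3))
      = sqrt (27 / 2 * ((3 ^ k)\<^sup>2 / (real k + 1) ^ 3))"
    by (simp add: power_add power2_eq_square flip: real_sqrt_mult)
  also have "\<dots> \<le> sqrt (16 * ((3 ^ k)\<^sup>2 / (real k + 1) ^ 3))"
    by (intro real_sqrt_le_mono mult_right_mono) auto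
  also have "\<dots> = 4 * 3 ^ k / sqrt (real k + 1) ^ 3"
    by (simp only: real_sqrt_mult real_sqrt_divide real_sqrt_abs real_sqrt_power[of "real k + 1" 3]) simp
  finally have "binomial_convolution f g k \<le> 2 * 2 ^ k * (4 * 3 ^ k / sqrt (real k + 1) ^ 3)" by simp
  also have "\<dots> = 8 * (2 * 3) ^ k / sqrt (real k + 1) ^ 3" by (simp only: power_mult_distrib) simp
  finally show ?thesis by simp
qed

lemma binomial_convolution_add_left:
  "binomial_convolution (\<lambda>i. f i + f' i) g k = binomial_convolution f g k + binomial_convolution f' g k"
  by (simp add: binomial_convolution_def sum.distrib algebra_simps)

lemma binomial_convolution_add_right:
  "binomial_convolution f (\<lambda>i. g i + g' i) k = binomial_convolution f g k + binomial_convolution f g' k"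
  by (simp add: binomial_convolution_def sum.distrib algebra_simps)

section \<open>Averages over step sequences\<close>

definition step_lists :: "nat \<Rightarrow> (int ^ 3) list set" where
  "step_lists n = {us. set us \<subseteq> unit_steps \<and> length us = n}"

text \<open>
  Expectation over \<open>n\<close> independent uniform steps. Working with finite averages avoids all
  questions of integrability and conditioning.
\<close>
definition path_mean :: "nat \<Rightarrow> ((int ^ 3) list \<Rightarrow> real) \<Rightarrow> real" where
  "path_mean n f = (\<Sum>us\<in>step_lists n. f us) / 6 ^ n"

lemma sum_unit_steps:
  fixes f :: "int ^ 'd \<Rightarrow> 'b :: comm_monoid_add"
  shows "(\<Sum>u\<in>unit_steps. f u) = (\<Sum>i\<in>UNIV. f (axis i 1) + f (axis i (- 1)))"
proof -
  have inj: "inj_on (\<lambda>(i, s). axis i s :: int ^ 'd) (UNIV \<times> {1, - 1})"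
    by (auto simp: inj_on_def axis_eq_axis)
  have "(unit_steps :: (int ^ 'd) set) = (\<lambda>(i, s). axis i s) ` (UNIV \<times> {1, - 1})"
    by (auto simp: unit_steps_def)
  then have "(\<Sum>u\<in>unit_steps. f u) = (\<Sum>(i, s)\<in>UNIV \<times> {1, - 1}. f (axis i s))"
    using sum.reindex[OF inj, of f] by (simp add: case_prod_unfold o_def)
  also have "\<dots> = (\<Sum>i\<in>UNIV. \<Sum>s\<in>{1, - 1}. f (axis i s))"
    by (rule sum.cartesian_product[symmetric])
  finally show ?thesis by simp
qed

lemma finite_unit_steps [simp]: "finite (unit_steps :: (int ^ 'd) set)"
proof -
  have "unit_steps \<subseteq> (\<lambda>(i, s). axis i s :: int ^ 'd) ` (UNIV \<times> {1, - 1})"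
    by (auto simp: unit_steps_def)
  then show ?thesis by (rule finite_subset) auto
qed

lemma card_unit_steps: "card (unit_steps :: (int ^ 3) set) = 6"
  using sum_unit_steps[of "\<lambda>_ :: int ^ 3. 1 :: nat"] by simp

lemma finite_step_lists [simp]: "finite (step_lists n)"
  unfolding step_lists_def by (rule finite_lists_length_eq) simp

lemma card_step_lists: "card (step_lists n) = 6 ^ n"
  unfolding step_lists_def by (subst card_lists_length_eq) (auto simp: card_unit_steps)

lemma length_step_lists: "us \<in> step_lists n \<Longrightarrow> length us = n"
  by (simp add: step_lists_def)

lemma path_mean_0 [simp]: "path_mean 0 f = f []"
proof -
  have "step_lists 0 = {[]}" by (auto simp: step_lists_def)
  then show ?thesis by (simp add: path_mean_def)
qed

lemma path_mean_const [simp]: "path_mean n (\<lambda>_. c) = c"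
  by (simp add: path_mean_def card_step_lists)

text \<open>
  The Markov property: given the first \<open>m\<close> steps, the next \<open>n\<close> steps are again uniform.
\<close>
lemma path_mean_append:
  "path_mean (m + n) f = path_mean m (\<lambda>us. path_mean n (\<lambda>vs. f (us @ vs)))"
proof -
  have "bij_betw (\<lambda>(us, vs). us @ vs) (step_lists m \<times> step_lists n) (step_lists (m + n))"
  proof (rule bij_betw_byWitness[where f' = "\<lambda>ws. (take m ws, drop m ws)"])
    show "(\<lambda>ws. (take m ws, drop m ws)) ` step_lists (m + n) \<subseteq> step_lists m \<times> step_lists n"
      by (auto simp: step_lists_def dest: in_set_takeD in_set_dropD)
  qed (auto simp: step_lists_def)
  then have "(\<Sum>ws\<in>step_lists (m + n). f ws) = (\<Sum>(us, vs)\<in>step_lists m \<times> step_lists n. f (us @ vs))"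
    by (subst sum.reindex_bij_betw[symmetric]) (auto simp: case_prod_unfold)
  also have "\<dots> = (\<Sum>us\<in>step_lists m. \<Sum>vs\<in>step_lists n. f (us @ vs))"
    by (rule sum.cartesian_product[symmetric])
  finally have "path_mean (m + n) f = (\<Sum>us\<in>step_lists m. \<Sum>vs\<in>step_lists n. f (us @ vs)) / 6 ^ n / 6 ^ m"
    by (simp add: path_mean_def power_add mult.commute)
  then show ?thesis unfolding path_mean_def by (simp only: sum_divide_distrib)
qed

lemma path_mean_1: "path_mean 1 f = (\<Sum>u\<in>unit_steps. f [u]) / 6"
proof -
  have "step_lists 1 = (\<lambda>u. [u]) ` unit_steps"
    by (auto simp: step_lists_def length_Suc_conv)
  then show ?thesis by (simp add: path_mean_def sum.reindex inj_on_def)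
qed

lemma path_mean_Suc: "path_mean (Suc n) f = (\<Sum>u\<in>unit_steps. path_mean n (\<lambda>us. f (u # us))) / 6"
  using path_mean_append[of 1 n f] by (simp add: path_mean_1[simplified])

lemma path_mean_mono:
  assumes "\<And>us. us \<in> step_lists n \<Longrightarrow> f us \<le> g us"
  shows "path_mean n f \<le> path_mean n g"
  unfolding path_mean_def using assms by (intro divide_right_mono sum_mono) auto

lemma path_mean_cong:
  assumes "\<And>us. us \<in> step_lists n \<Longrightarrow> f us = g us"
  shows "path_mean n f = path_mean n g"
  unfolding path_mean_def using assms by (intro arg_cong2[where f = "(/)"] sum.cong) auto

lemma path_mean_sum: "path_mean n (\<lambda>us. \<Sum>i\<in>I. f i us) = (\<Sum>i\<in>I. path_mean n (f i))"
  unfolding path_mean_def by (subst sum.swap) (simp add: sum_divide_distrib)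

lemma path_mean_plus: "path_mean n (\<lambda>us. f us + g us) = path_mean n f + path_mean n g"
  by (simp add: path_mean_def sum.distrib add_divide_distrib)

lemma path_mean_cmult: "path_mean n (\<lambda>us. c * f us) = c * path_mean n f"
  unfolding path_mean_def by (simp only: sum_distrib_left[symmetric] times_divide_eq_right)

lemma path_mean_nonneg: "(\<And>us. us \<in> step_lists n \<Longrightarrow> f us \<ge> 0) \<Longrightarrow> path_mean n f \<ge> 0"
  unfolding path_mean_def by (intro divide_nonneg_nonneg sum_nonneg) auto

section \<open>The heat kernel of the walk\<close>

text \<open>
  Sort the steps by the coordinate that they change.
\<close>
lemma endpoint_law_eq_convolution:
  "6 ^ k * path_mean k (\<lambda>us. of_bool (sum_list us = x)) =
     binomial_convolution (\<lambda>i. line_paths i (x $ 1))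
       (binomial_convolution (\<lambda>i. line_paths i (x $ 2)) (\<lambda>i. line_paths i (x $ 3))) k"
proof (induction k arbitrary: x)
  case 0
  have "(0 = x) = (x $ 1 = 0 \<and> x $ 2 = 0 \<and> x $ 3 = 0)"
    by (auto simp: vec_eq_iff forall_3)
  then show ?case by (simp add: binomial_convolution_def)
next
  case (Suc k)
  define W where "W = (\<lambda>x. 6 ^ k * path_mean k (\<lambda>us. of_bool (sum_list us = x)))"
  have shift: "(u + s = x) = (s = x - u)" for u s :: "int ^ 3" by (auto simp: algebra_simps)
  have "6 ^ Suc k * path_mean (Suc k) (\<lambda>us. of_bool (sum_list us = x)) = (\<Sum>u\<in>unit_steps. W (x - u))"
    by (simp add: path_mean_Suc W_def shift flip: sum_distrib_left)
  also have "\<dots> = (\<Sum>i\<in>UNIV. W (x - axis i 1) + W (x - axis i (- 1)))"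
    by (rule sum_unit_steps)
  finally show ?case
    unfolding W_def Suc.IH
    by (simp add: sum_3 axis_def binomial_convolution_Suc binomial_convolution_add_left binomial_convolution_add_right)
qed

lemma heat_kernel_bound:
  "path_mean k (\<lambda>us. of_bool (sum_list us = x)) \<le> 8 / sqrt (real k + 1) ^ 3"
proof -
  define f where "f j = (\<lambda>i. real (line_paths i (x $ j)))" for j
  have f: "0 \<le> f j i \<and> f j i \<le> 2 ^ i / sqrt (real (i + 1))" for i j
    unfolding f_def using line_paths_bound[of i "x $ j"] by simp
  have f23: "0 \<le> binomial_convolution (f 2) (f 3) i \<and> binomial_convolution (f 2) (f 3) i \<le> 2 * 4 ^ i / (real i + 1)" for i
    using plane_convolution_bound[of "f 2" "f 3" i] f
    by (auto simp: binomial_convolution_def intro!: sum_nonneg mult_nonneg_nonneg)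
  have "6 ^ k * path_mean k (\<lambda>us. of_bool (sum_list us = x)) \<le> 8 * 6 ^ k / sqrt (real k + 1) ^ 3"
    using space_convolution_bound[of "f 1" "binomial_convolution (f 2) (f 3)" k] f f23
    by (simp add: f_def endpoint_law_eq_convolution)
  then have "6 ^ k * path_mean k (\<lambda>us. of_bool (sum_list us = x)) \<le> 6 ^ k * (8 / sqrt (real k + 1) ^ 3)"
    by (simp add: mult.commute)
  then show ?thesis by (subst (asm) mult_le_cancel_left_pos) auto
qed

lemma path_mean_take:
  assumes "j \<le> n"
  shows "path_mean n (\<lambda>us. f (take j us)) = path_mean j f"
proof -
  have "path_mean (j + (n - j)) (\<lambda>us. f (take j us)) = path_mean j (\<lambda>us. path_mean (n - j) (\<lambda>vs. f (take j (us @ vs))))"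
    by (rule path_mean_append)
  also have "\<dots> = path_mean j f"
    by (rule path_mean_cong) (simp add: length_step_lists)
  finally show ?thesis using assms by simp
qed

lemma path_mean_drop:
  assumes "i \<le> n"
  shows "path_mean n (\<lambda>us. f (drop i us)) = path_mean (n - i) f"
proof -
  have "path_mean (i + (n - i)) (\<lambda>us. f (drop i us)) = path_mean i (\<lambda>us. path_mean (n - i) (\<lambda>vs. f (drop i (us @ vs))))"
    by (rule path_mean_append)
  also have "\<dots> = path_mean i (\<lambda>_. path_mean (n - i) f)"
    by (rule path_mean_cong) (simp add: length_step_lists)
  finally show ?thesis using assms by simp
qed

definition position :: "(int ^ 3) list \<Rightarrow> nat \<Rightarrow> int ^ 3" where
  "position us j = sum_list (take j us)"

lemma path_mean_position:
  assumes "j \<le> n"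
  shows "path_mean n (\<lambda>us. f (position us j)) = path_mean j (\<lambda>us. f (sum_list us))"
  unfolding position_def using assms by (rule path_mean_take)

lemma path_mean_increment:
  assumes "i \<le> j" "j \<le> n"
  shows "path_mean n (\<lambda>us. f (position us j - position us i)) = path_mean (j - i) (\<lambda>us. f (sum_list us))"
proof -
  have "position us j - position us i = sum_list (take (j - i) (drop i us))" for us
    using take_add[of i "j - i" us] assms by (simp add: position_def)
  then have "path_mean n (\<lambda>us. f (position us j - position us i))
      = path_mean n (\<lambda>us. f (sum_list (take (j - i) (drop i us))))" by simp
  also have "\<dots> = path_mean (n - i) (\<lambda>us. f (sum_list (take (j - i) us)))"
    using assms by (intro path_mean_drop) auto
  also have "\<dots> = path_mean (j - i) (\<lambda>us. f (sum_list us))"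
    using assms by (intro path_mean_take) auto
  finally show ?thesis .
qed

text \<open>
  The heat kernel bound gives \<open>min 1 (a\<^sup>3)\<close> with \<open>a\<close> the right-hand side, and \<open>min 1 (a\<^sup>3) \<le> a\<close>. Unlike
  the cube, \<open>a\<close> may be summed over all \<open>k < L\<close> without treating small \<open>k\<close> separately, and the
  sum of order \<open>c sqrt L\<close> is small compared with \<open>L\<close> as soon as \<open>c\<close> is small compared with \<open>sqrt L\<close>.
\<close>
lemma endpoint_in_set_bound:
  assumes "finite H" "real (card H) \<le> c ^ 3" "c \<ge> 0"
  shows "path_mean k (\<lambda>us. of_bool (y + sum_list us \<in> H)) \<le> 2 * c / sqrt (real k + 1)"
proof -
  define a where "a = 2 * c / sqrt (real k + 1)"
  have a: "a \<ge> 0" using assms by (simp add: a_def)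
  have "path_mean k (\<lambda>us. of_bool (y + sum_list us \<in> H)) \<le> path_mean k (\<lambda>us. 1)"
    by (rule path_mean_mono) auto
  then have le_1: "path_mean k (\<lambda>us. of_bool (y + sum_list us \<in> H)) \<le> 1" by simp
  have "path_mean k (\<lambda>us. of_bool (y + sum_list us \<in> H)) = path_mean k (\<lambda>us. \<Sum>x\<in>H. of_bool (sum_list us = x - y))"
  proof (rule path_mean_cong)
    fix us
    have "(\<Sum>x\<in>H. of_bool (sum_list us = x - y)) = (\<Sum>x\<in>H. if x = y + sum_list us then 1 else (0::real))"
      by (intro sum.cong) (auto simp: algebra_simps)
    then show "of_bool (y + sum_list us \<in> H) = (\<Sum>x\<in>H. of_bool (sum_list us = x - y) :: real)"
      using \<open>finite H\<close> by simp
  qed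
  also have "\<dots> = (\<Sum>x\<in>H. path_mean k (\<lambda>us. of_bool (sum_list us = x - y)))"
    by (rule path_mean_sum)
  also have "\<dots> \<le> (\<Sum>x\<in>H. 8 / sqrt (real k + 1) ^ 3)"
    by (intro sum_mono heat_kernel_bound)
  also have "\<dots> = real (card H) * (8 / sqrt (real k + 1) ^ 3)" by simp
  also have "\<dots> \<le> c ^ 3 * (8 / sqrt (real k + 1) ^ 3)"
    using assms by (intro mult_right_mono) auto
  also have "\<dots> = a ^ 3" by (simp add: a_def power_divide power_mult_distrib)
  finally have le_cube: "path_mean k (\<lambda>us. of_bool (y + sum_list us \<in> H)) \<le> a ^ 3" .
  show ?thesis
  proof (cases "a \<le> 1")
    case True
    then have "a ^ 3 \<le> a ^ 1" using a by (intro power_decreasing) auto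
    with le_cube show ?thesis by (simp add: a_def)
  next
    case False
    with le_1 show ?thesis unfolding a_def by linarith
  qed
qed

lemma sum_inverse_sqrt_le: "(\<Sum>j<L. 1 / sqrt (real j + 1)) \<le> 2 * sqrt (real L)"
proof (induction L)
  case 0
  then show ?case by simp
next
  case (Suc L)
  define s t where "s = sqrt (real L)" and "t = sqrt (real L + 1)"
  have st: "s\<^sup>2 = real L" "t\<^sup>2 = real L + 1" "0 < t" "0 \<le> s" by (auto simp: s_def t_def)
  have "(t - s)\<^sup>2 \<ge> 0" by simp
  then have "2 * s * t + 1 \<le> 2 * t * t" using st by (simp add: power2_eq_square algebra_simps)
  then have "2 * s + 1 / t \<le> 2 * t" using st by (simp add: field_simps)
  moreover have "(\<Sum>j<Suc L. 1 / sqrt (real j + 1)) = (\<Sum>j<L. 1 / sqrt (real j + 1)) + 1 / t"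
    by (simp add: t_def)
  moreover have "sqrt (real (Suc L)) = t" by (simp add: t_def add.commute)
  ultimately show ?case using Suc.IH by (simp add: s_def)
qed

lemma mean_time_in_set_le:
  assumes "finite H" "real (card H) \<le> c ^ 3" "c \<ge> 0"
  shows "path_mean L (\<lambda>us. \<Sum>j<L. of_bool (y + position us j \<in> H)) \<le> 4 * c * sqrt (real L)"
proof -
  have "path_mean L (\<lambda>us. \<Sum>j<L. of_bool (y + position us j \<in> H))
      = (\<Sum>j<L. path_mean L (\<lambda>us. of_bool (y + position us j \<in> H)))"
    by (rule path_mean_sum)
  also have "\<dots> = (\<Sum>j<L. path_mean j (\<lambda>us. of_bool (y + sum_list us \<in> H)))"
    by (intro sum.cong refl path_mean_position) auto
  also have "\<dots> \<le> (\<Sum>j<L. 2 * c / sqrt (real j + 1))"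
    using assms by (intro sum_mono endpoint_in_set_bound)
  also have "\<dots> = 2 * c * (\<Sum>j<L. 1 / sqrt (real j + 1))" by (simp add: sum_distrib_left)
  also have "\<dots> \<le> 2 * c * (2 * sqrt (real L))"
    using assms by (intro mult_left_mono sum_inverse_sqrt_le) auto
  finally show ?thesis by simp
qed

text \<open>
  Up to a factor, this bounds the expected number of returns to the starting point, which is finite
  because the walk is transient.
\<close>
definition return_constant :: real where
  "return_constant = (\<Sum>d. 1 / sqrt (real d + 1) ^ 3)"

lemma summable_return: "summable (\<lambda>d. 1 / sqrt (real d + 1) ^ 3)"
proof -
  have eq: "1 / sqrt (real d + 1) ^ 3 = real (Suc d) powr (- 3 / 2)" for d
    by (simp add: powr_minus_divide powr_half_sqrt[symmetric] powr_power add.commute)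
  have "summable (\<lambda>d. real d powr (- 3 / 2))" by (simp add: summable_real_powr_iff)
  then have "summable (\<lambda>d. real (Suc d) powr (- 3 / 2))" by (subst summable_Suc_iff)
  then show ?thesis by (simp only: eq)
qed

lemma sum_return_le: "(\<Sum>d\<in>D. 1 / sqrt (real d + 1) ^ 3) \<le> return_constant" if "finite D" for D
  unfolding return_constant_def using that by (intro sum_le_suminf summable_return) auto

lemma return_constant_nonneg: "0 \<le> return_constant"
  using sum_return_le[of "{}"] by simp

lemma mean_self_intersections_le:
  "path_mean L (\<lambda>us. \<Sum>i<L. \<Sum>j<L. of_bool (position us i = position us j)) \<le> 16 * return_constant * real L"
proof -
  have pair: "path_mean L (\<lambda>us. of_bool (position us i = position us j)) \<le> 8 / sqrt (real (j - i) + 1) ^ 3"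
    if "i \<le> j" "j < L" for i j
  proof -
    have "path_mean L (\<lambda>us. of_bool (position us i = position us j))
        = path_mean L (\<lambda>us. of_bool (position us j - position us i = 0))"
      by (intro path_mean_cong arg_cong[where f = of_bool]) auto
    also have "\<dots> = path_mean (j - i) (\<lambda>us. of_bool (sum_list us = 0))"
      using that by (intro path_mean_increment[where f = "\<lambda>x. of_bool (x = 0)"]) auto
    also have "\<dots> \<le> 8 / sqrt (real (j - i) + 1) ^ 3" by (rule heat_kernel_bound)
    finally show ?thesis .
  qed
  \<comment> \<open>Each pair of times is counted from both of its members, so returns are summed over the future and the past.\<close>
  have later: "(\<Sum>j\<in>{i..<L}. path_mean L (\<lambda>us. of_bool (position us i = position us j))) \<le> 8 * return_constant"
    for i
  proof -
    have "(\<Sum>j\<in>{i..<L}. path_mean L (\<lambda>us. of_bool (position us i = position us j)))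
        \<le> (\<Sum>j\<in>{i..<L}. 8 * (1 / sqrt (real (j - i) + 1) ^ 3))"
      using pair by (intro sum_mono) auto
    also have "\<dots> = 8 * (\<Sum>d\<in>(\<lambda>j. j - i) ` {i..<L}. 1 / sqrt (real d + 1) ^ 3)"
      by (subst sum.reindex) (auto simp: inj_on_def sum_distrib_left)
    also have "\<dots> \<le> 8 * return_constant" by (intro mult_left_mono sum_return_le) auto
    finally show ?thesis .
  qed
  have earlier: "(\<Sum>j\<in>{..<i}. path_mean L (\<lambda>us. of_bool (position us i = position us j))) \<le> 8 * return_constant"
    if "i < L" for i
  proof -
    have "(\<Sum>j\<in>{..<i}. path_mean L (\<lambda>us. of_bool (position us i = position us j)))
        \<le> (\<Sum>j\<in>{..<i}. 8 * (1 / sqrt (real (i - j) + 1) ^ 3))"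
    proof (rule sum_mono)
      fix j assume "j \<in> {..<i}"
      then show "path_mean L (\<lambda>us. of_bool (position us i = position us j)) \<le> 8 * (1 / sqrt (real (i - j) + 1) ^ 3)"
        using pair[of j i] that unfolding eq_commute[of "position _ i" "position _ j"] by simp
    qed
    also have "\<dots> = 8 * (\<Sum>d\<in>(\<lambda>j. i - j) ` {..<i}. 1 / sqrt (real d + 1) ^ 3)"
      by (subst sum.reindex) (auto simp: inj_on_def sum_distrib_left)
    also have "\<dots> \<le> 8 * return_constant" by (intro mult_left_mono sum_return_le) auto
    finally show ?thesis .
  qed
  have "path_mean L (\<lambda>us. \<Sum>i<L. \<Sum>j<L. of_bool (position us i = position us j))
      = (\<Sum>i<L. \<Sum>j<L. path_mean L (\<lambda>us. of_bool (position us i = position us j)))"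
    by (simp only: path_mean_sum)
  also have "\<dots> \<le> (\<Sum>i<L. 16 * return_constant)"
  proof (rule sum_mono)
    fix i assume "i \<in> {..<L}"
    then have i: "i < L" by simp
    then have "{..<L} = {..<i} \<union> {i..<L}" by auto
    then have "(\<Sum>j<L. path_mean L (\<lambda>us. of_bool (position us i = position us j)))
        = (\<Sum>j\<in>{..<i}. path_mean L (\<lambda>us. of_bool (position us i = position us j)))
          + (\<Sum>j\<in>{i..<L}. path_mean L (\<lambda>us. of_bool (position us i = position us j)))"
      by (simp add: sum.union_disjoint ivl_disj_int)
    then show "(\<Sum>j<L. path_mean L (\<lambda>us. of_bool (position us i = position us j))) \<le> 16 * return_constant"
      using earlier[OF i] later[of i] by simp
  qed
  finally show ?thesis by (simp add: mult.commute)
qed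

section \<open>Blocks of the path\<close>

text \<open>
  The final position of the path is not counted, so that the visits in consecutive blocks add up.
\<close>
definition visits :: "(int ^ 3) list \<Rightarrow> int ^ 3 \<Rightarrow> nat" where
  "visits us x = card {j. j < length us \<and> position us j = x}"

definition heavy_sites :: "real \<Rightarrow> (int ^ 3) list \<Rightarrow> (int ^ 3) set" where
  "heavy_sites \<theta> us = {x. real (visits us x) > \<theta>}"

lemma finite_heavy_sites:
  assumes "\<theta> \<ge> 0"
  shows "finite (heavy_sites \<theta> us)"
proof (rule finite_subset)
  show "heavy_sites \<theta> us \<subseteq> position us ` {..<length us}"
  proof
    fix x assume "x \<in> heavy_sites \<theta> us"
    then have "visits us x \<noteq> 0" using assms by (auto simp: heavy_sites_def)
    then have "{j. j < length us \<and> position us j = x} \<noteq> {}" unfolding visits_def by (metis card.empty)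
    then show "x \<in> position us ` {..<length us}" by auto
  qed
qed auto

text \<open>
  \<open>us\<close> is the past of the block and \<open>vs\<close> the block. The bound \<open>h\<close> on the number of heavy sites is part
  of the first alternative, so that no block is likely to be bad, whatever its past.
\<close>
definition bad_block :: "real \<Rightarrow> real \<Rightarrow> nat \<Rightarrow> (int ^ 3) list \<Rightarrow> (int ^ 3) list \<Rightarrow> bool" where
  "bad_block \<theta> h m us vs \<longleftrightarrow>
     real (card (heavy_sites \<theta> us)) \<le> h
       \<and> length vs \<le> 4 * card {j. j < length vs \<and> sum_list us + position vs j \<in> heavy_sites \<theta> us}
     \<or> length vs \<le> 4 * card {j. j < length vs \<and> visits vs (position vs j) > m}"

lemma real_card_eq_sum: "real (card {j. j < (L::nat) \<and> P j}) = (\<Sum>j<L. of_bool (P j))"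
proof -
  have "{j. j < L \<and> P j} = {j \<in> {..<L}. P j}" by auto
  then show ?thesis by (simp add: sum.If_cases of_bool_def Int_def)
qed

lemma path_mean_markov:
  assumes "L > 0" "path_mean n f \<le> C"
    and "\<And>us. us \<in> step_lists n \<Longrightarrow> P us \<Longrightarrow> real L \<le> 4 * f us"
    and "\<And>us. us \<in> step_lists n \<Longrightarrow> f us \<ge> 0"
  shows "path_mean n (\<lambda>us. of_bool (P us)) \<le> 4 / real L * C"
proof -
  have "path_mean n (\<lambda>us. of_bool (P us)) \<le> path_mean n (\<lambda>us. 4 / real L * f us)"
  proof (rule path_mean_mono)
    fix us assume us: "us \<in> step_lists n"
    show "of_bool (P us) \<le> 4 / real L * f us"
      using assms(1) assms(3)[OF us] assms(4)[OF us] by (cases "P us") (auto simp: field_simps)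
  qed
  also have "\<dots> \<le> 4 / real L * C"
    unfolding path_mean_cmult using assms by (intro mult_left_mono) auto
  finally show ?thesis .
qed

text \<open>
  The right-hand side counts the self-intersections of the block, and a time at a site with more than
  \<open>m\<close> visits takes part in more than \<open>m\<close> of them.
\<close>
lemma crowded_times_le:
  "real m * real (card {j. j < length vs \<and> visits vs (position vs j) > m})
     \<le> (\<Sum>i<length vs. \<Sum>j<length vs. of_bool (position vs i = position vs j))"
proof -
  have "real m * real (card {j. j < length vs \<and> visits vs (position vs j) > m})
      = (\<Sum>j<length vs. real m * of_bool (visits vs (position vs j) > m))"
    by (simp add: real_card_eq_sum sum_distrib_left)
  also have "\<dots> \<le> (\<Sum>j<length vs. real (visits vs (position vs j)))"
    by (intro sum_mono) auto
  also have "\<dots> = (\<Sum>j<length vs. \<Sum>i<length vs. of_bool (position vs i = position vs j))"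
    by (simp add: visits_def real_card_eq_sum)
  also have "\<dots> = (\<Sum>i<length vs. \<Sum>j<length vs. of_bool (position vs i = position vs j))"
    by (rule sum.swap)
  finally show ?thesis .
qed

text \<open>
  Markov's inequality for the time in the heavy sites and for the number of self-intersections.
\<close>
lemma bad_block_mean_le:
  assumes "\<theta> \<ge> 0" "c \<ge> 0" "h \<le> c ^ 3" "m > 0" "L > 0"
  shows "path_mean L (\<lambda>vs. of_bool (bad_block \<theta> h m us vs))
           \<le> 16 * c / sqrt (real L) + 64 * return_constant / real m"
proof -
  define H where "H = heavy_sites \<theta> us"
  define y where "y = sum_list us"
  have old: "path_mean L (\<lambda>vs. of_bool (real (card H) \<le> h \<and>
      length vs \<le> 4 * card {j. j < length vs \<and> y + position vs j \<in> H})) \<le> 16 * c / sqrt (real L)"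
  proof (cases "real (card H) \<le> h")
    case True
    have "path_mean L (\<lambda>vs. of_bool (real (card H) \<le> h \<and>
        length vs \<le> 4 * card {j. j < length vs \<and> y + position vs j \<in> H})) \<le> 4 / real L * (4 * c * sqrt (real L))"
    proof (rule path_mean_markov[OF \<open>L > 0\<close> mean_time_in_set_le[where H = H and y = y]])
      show "finite H" unfolding H_def using assms by (intro finite_heavy_sites)
      fix vs assume vs: "vs \<in> step_lists L"
      assume "real (card H) \<le> h \<and> length vs \<le> 4 * card {j. j < length vs \<and> y + position vs j \<in> H}"
      then have "real (length vs) \<le> 4 * real (card {j. j < length vs \<and> y + position vs j \<in> H})" by linarith
      then show "real L \<le> 4 * (\<Sum>j<L. of_bool (y + position vs j \<in> H))"
        unfolding real_card_eq_sum length_step_lists[OF vs] .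
    qed (use assms True in \<open>auto intro: sum_nonneg\<close>)
    also have "\<dots> = 16 * c / sqrt (real L)" using \<open>L > 0\<close> by (simp add: field_simps)
    finally show ?thesis .
  qed (use assms in simp)
  have crowded: "path_mean L (\<lambda>vs. of_bool (length vs \<le> 4 * card {j. j < length vs \<and> visits vs (position vs j) > m}))
      \<le> 64 * return_constant / real m"
  proof -
    have "path_mean L (\<lambda>vs. of_bool (length vs \<le> 4 * card {j. j < length vs \<and> visits vs (position vs j) > m}))
        \<le> 4 / real L * (1 / real m * (16 * return_constant * real L))"
    proof (rule path_mean_markov[OF \<open>L > 0\<close>])
      show "path_mean L (\<lambda>vs. 1 / real m * (\<Sum>i<L. \<Sum>j<L. of_bool (position vs i = position vs j)))
          \<le> 1 / real m * (16 * return_constant * real L)"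
        unfolding path_mean_cmult by (intro mult_left_mono mean_self_intersections_le) auto
      fix vs assume vs: "vs \<in> step_lists L"
      assume "length vs \<le> 4 * card {j. j < length vs \<and> visits vs (position vs j) > m}"
      then have "real (length vs) \<le> 4 * real (card {j. j < length vs \<and> visits vs (position vs j) > m})" by linarith
      moreover have "real (card {j. j < length vs \<and> visits vs (position vs j) > m})
          \<le> 1 / real m * (\<Sum>i<length vs. \<Sum>j<length vs. of_bool (position vs i = position vs j))"
        using crowded_times_le[of m vs] \<open>m > 0\<close> by (simp add: field_simps)
      ultimately show "real L \<le> 4 * (1 / real m * (\<Sum>i<L. \<Sum>j<L. of_bool (position vs i = position vs j)))"
        unfolding length_step_lists[OF vs] by linarith
    qed (auto intro!: sum_nonneg mult_nonneg_nonneg divide_nonneg_nonneg)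
    also have "\<dots> = 64 * return_constant / real m" using \<open>L > 0\<close> by simp
    finally show ?thesis .
  qed
  have "path_mean L (\<lambda>vs. of_bool (bad_block \<theta> h m us vs))
      \<le> path_mean L (\<lambda>vs. of_bool (real (card H) \<le> h \<and>
            length vs \<le> 4 * card {j. j < length vs \<and> y + position vs j \<in> H})
          + of_bool (length vs \<le> 4 * card {j. j < length vs \<and> visits vs (position vs j) > m}))"
    by (rule path_mean_mono) (auto simp: bad_block_def H_def y_def)
  then show ?thesis using old crowded unfolding path_mean_plus by linarith
qed

text \<open>
  The notion \<open>B\<close> of badness is arbitrary, since only its probability given the past of a block matters
  for the number of bad blocks.
\<close>
definition bad_indices :: "((int ^ 3) list \<Rightarrow> (int ^ 3) list \<Rightarrow> bool) \<Rightarrow> nat \<Rightarrow> nat \<Rightarrow> (int ^ 3) list \<Rightarrow> nat set" where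
  "bad_indices B L N ws = {b. b < N \<and> B (take (b * L) ws) (take L (drop (b * L) ws))}"

lemma bad_indices_append:
  assumes "length us = N * L" "length vs = L"
  shows "card (bad_indices B L (Suc N) (us @ vs)) = card (bad_indices B L N us) + of_bool (B us vs)"
proof -
  have eq: "B (take (b * L) (us @ vs)) (take L (drop (b * L) (us @ vs))) = B (take (b * L) us) (take L (drop (b * L) us))"
    if "b < N" for b
  proof -
    have "Suc b * L \<le> N * L" using that by (intro mult_le_mono1) simp
    then have "b * L + L \<le> length us" using assms by simp
    then have "b * L \<le> length us" "L \<le> length us - b * L" by linarith+
    then show ?thesis by simp
  qed
  have "bad_indices B L (Suc N) (us @ vs) = bad_indices B L N us \<union> (if B us vs then {N} else {})"
    using eq assms by (auto simp: bad_indices_def less_Suc_eq)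
  moreover have "finite (bad_indices B L N us)" "N \<notin> bad_indices B L N us" by (auto simp: bad_indices_def)
  ultimately show ?thesis by simp
qed

text \<open>
  The blocks are not independent, but each one is bad with probability at most \<open>p\<close> given its past;
  so the last block contributes at most the factor \<open>1 + s p\<close>.
\<close>
lemma bad_indices_exponential_moment:
  assumes bad: "\<And>us. path_mean L (\<lambda>vs. of_bool (B us vs)) \<le> p" and s: "s \<ge> 0"
  shows "path_mean (N * L) (\<lambda>ws. s ^ card (bad_indices B L N ws)) \<le> (1 + s * p) ^ N"
proof (induction N)
  case 0
  then show ?case by (simp add: bad_indices_def)
next
  case (Suc N)
  have p: "p \<ge> 0" using bad[of "[]"] path_mean_nonneg[of L "\<lambda>vs. of_bool (B [] vs)"] by simp
  have "path_mean (Suc N * L) (\<lambda>ws. s ^ card (bad_indices B L (Suc N) ws))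
      = path_mean (N * L) (\<lambda>us. path_mean L (\<lambda>vs. s ^ card (bad_indices B L (Suc N) (us @ vs))))"
    using path_mean_append[of "N * L" L] by (simp add: add.commute)
  also have "\<dots> \<le> path_mean (N * L) (\<lambda>us. (1 + s * p) * s ^ card (bad_indices B L N us))"
  proof (rule path_mean_mono)
    fix us assume us: "us \<in> step_lists (N * L)"
    let ?k = "s ^ card (bad_indices B L N us)"
    have "path_mean L (\<lambda>vs. s ^ card (bad_indices B L (Suc N) (us @ vs))) \<le> path_mean L (\<lambda>vs. ?k + (?k * s) * of_bool (B us vs))"
    proof (rule path_mean_mono)
      fix vs assume vs: "vs \<in> step_lists L"
      show "s ^ card (bad_indices B L (Suc N) (us @ vs)) \<le> ?k + (?k * s) * of_bool (B us vs)"
        using bad_indices_append[OF length_step_lists[OF us] length_step_lists[OF vs], of B] s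
        by (cases "B us vs") (auto simp: mult.commute)
    qed
    also have "\<dots> = ?k + (?k * s) * path_mean L (\<lambda>vs. of_bool (B us vs))"
      by (simp add: path_mean_plus path_mean_cmult)
    also have "\<dots> \<le> ?k + (?k * s) * p"
      using bad[of us] s by (intro add_left_mono mult_left_mono) auto
    finally show "path_mean L (\<lambda>vs. s ^ card (bad_indices B L (Suc N) (us @ vs))) \<le> (1 + s * p) * ?k"
      by (simp add: algebra_simps)
  qed
  also have "\<dots> \<le> (1 + s * p) * (1 + s * p) ^ N"
    unfolding path_mean_cmult using Suc.IH p s by (intro mult_left_mono) auto
  finally show ?case by simp
qed

text \<open>
  Chernoff bound with \<open>s = exp (4 K)\<close>, for which \<open>s p \<le> 1\<close>.
\<close>
lemma many_bad_blocks_le: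
  assumes bad: "\<And>us. path_mean L (\<lambda>vs. of_bool (B us vs)) \<le> exp (- 4 * K)"
    and K: "K \<ge> 0"
  shows "path_mean (N * L) (\<lambda>ws. of_bool (N \<le> 4 * card (bad_indices B L N ws))) \<le> (2 * exp (- K)) ^ N"
proof -
  have "path_mean (N * L) (\<lambda>ws. of_bool (N \<le> 4 * card (bad_indices B L N ws)))
      \<le> path_mean (N * L) (\<lambda>ws. exp (- K) ^ N * exp (4 * K) ^ card (bad_indices B L N ws))"
  proof (rule path_mean_mono)
    fix ws
    show "of_bool (N \<le> 4 * card (bad_indices B L N ws)) \<le> exp (- K) ^ N * exp (4 * K) ^ card (bad_indices B L N ws)"
    proof (cases "N \<le> 4 * card (bad_indices B L N ws)")
      case True
      then have "real N * K \<le> real (4 * card (bad_indices B L N ws)) * K"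
        using K by (intro mult_right_mono of_nat_mono) auto
      then have "1 \<le> exp (real N * (- K) + real (card (bad_indices B L N ws)) * (4 * K))"
        by (simp add: algebra_simps)
      also have "\<dots> = exp (- K) ^ N * exp (4 * K) ^ card (bad_indices B L N ws)"
        by (simp only: exp_add exp_of_nat_mult)
      finally show ?thesis using True by simp
    qed simp
  qed
  also have "\<dots> \<le> exp (- K) ^ N * (1 + exp (4 * K) * exp (- 4 * K)) ^ N"
    unfolding path_mean_cmult using bad by (intro mult_left_mono bad_indices_exponential_moment) auto
  also have "\<dots> = (2 * exp (- K)) ^ N"
    by (simp add: power_mult_distrib mult.commute flip: exp_add)
  finally show ?thesis .
qed

section \<open>Time at sites that are not yet heavy\<close>

lemma visits_take_le: "visits (take k us) x \<le> visits us x"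
  unfolding visits_def
proof (rule card_mono)
  show "{j. j < length (take k us) \<and> position (take k us) j = x} \<subseteq> {j. j < length us \<and> position us j = x}"
    by (auto simp: position_def)
qed auto

lemma position_block:
  assumes "j < L"
  shows "position us (b * L + j) = sum_list (take (b * L) us) + position (take L (drop (b * L) us)) j"
  using assms by (simp add: position_def take_add)

lemma heavy_sites_take_subset: "heavy_sites \<theta> (take k us) \<subseteq> heavy_sites \<theta> us"
proof
  fix x assume "x \<in> heavy_sites \<theta> (take k us)"
  moreover have "real (visits (take k us) x) \<le> real (visits us x)"
    using visits_take_le by (rule of_nat_mono)
  ultimately show "x \<in> heavy_sites \<theta> us" unfolding heavy_sites_def mem_Collect_eq by linarith
qed

text \<open>
  In a good block, at least half of the times are fresh: the site is not yet heavy when the block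
  begins, and the block visits it at most \<open>m\<close> times. More than \<open>3/4\<close> of the blocks are good, which
  gives the left-hand side. On the right-hand side the fresh times are counted by site.
\<close>
lemma occupation_le_of_few_bad_blocks:
  assumes len: "length us = N * L" and "L > 0" "\<theta> \<ge> 0" and "finite \<Lambda>"
    and inside: "\<And>j. j < N * L \<Longrightarrow> position us j \<in> \<Lambda>"
    and heavy: "real (card (heavy_sites \<theta> us)) \<le> h"
    and few: "4 * card (bad_indices (bad_block \<theta> h m) L N us) < N"
  shows "3 / 8 * real (N * L) \<le> \<theta> * real (card \<Lambda>) + real m * h"
proof -
  define past where "past b = take (b * L) us" for b
  define blk where "blk b = take L (drop (b * L) us)" for b
  define good where "good = {..<N} - bad_indices (bad_block \<theta> h m) L N us"
  define fresh where "fresh b = {j. j < L \<and> position us (b * L + j) \<notin> heavy_sites \<theta> (past b)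
      \<and> visits (blk b) (position (blk b) j) \<le> m}" for b
  define fiber where "fiber x = {(b, j). b \<in> good \<and> j \<in> fresh b \<and> position us (b * L + j) = x}" for x
  have in_range: "b * L + j < N * L" if "b < N" "j < L" for b j
  proof -
    have "b * L + j < Suc b * L" using that by simp
    also have "\<dots> \<le> N * L" using that by (intro mult_le_mono1) simp
    finally show ?thesis .
  qed
  have len_past: "length (past b) = b * L" if "b < N" for b
    using that len by (simp add: past_def)
  have len_blk: "length (blk b) = L" if "b < N" for b
  proof -
    have "Suc b * L \<le> N * L" using that by (intro mult_le_mono1) simp
    then show ?thesis using len by (simp add: blk_def)
  qed
  have good_lt: "b < N" if "b \<in> good" for b using that by (simp add: good_def)
  have fin: "finite good" "finite (fresh b)" for b by (simp_all add: good_def fresh_def)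
  have fresh_ge: "real L / 2 \<le> real (card (fresh b))" if b: "b \<in> good" for b
  proof -
    define old where "old = {j. j < L \<and> sum_list (past b) + position (blk b) j \<in> heavy_sites \<theta> (past b)}"
    define crowded where "crowded = {j. j < L \<and> visits (blk b) (position (blk b) j) > m}"
    have "card (heavy_sites \<theta> (past b)) \<le> card (heavy_sites \<theta> us)"
      unfolding past_def by (intro card_mono finite_heavy_sites heavy_sites_take_subset assms)
    then have "real (card (heavy_sites \<theta> (past b))) \<le> h" using heavy by linarith
    moreover have "\<not> bad_block \<theta> h m (past b) (blk b)"
      using b by (auto simp: good_def bad_indices_def past_def blk_def)
    ultimately have "4 * card old < L" "4 * card crowded < L"
      using len_blk[OF good_lt[OF b]] by (auto simp: bad_block_def old_def crowded_def)
    moreover have "fresh b = {..<L} - (old \<union> crowded)"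
      using position_block[of _ L us b] by (auto simp: fresh_def old_def crowded_def past_def blk_def)
    then have "L - card (old \<union> crowded) \<le> card (fresh b)"
      using diff_card_le_card_Diff[of "old \<union> crowded" "{..<L}"] by (simp add: old_def crowded_def)
    moreover have "card (old \<union> crowded) \<le> card old + card crowded" by (rule card_Un_le)
    ultimately show ?thesis by linarith
  qed
  have "4 * card good > 3 * N"
  proof -
    have "N - card (bad_indices (bad_block \<theta> h m) L N us) \<le> card good"
      using diff_card_le_card_Diff[of "bad_indices (bad_block \<theta> h m) L N us" "{..<N}"]
      by (simp add: good_def bad_indices_def)
    then show ?thesis using few by linarith
  qed
  then have "3 / 4 * real N \<le> real (card good)" by linarith
  then have "3 / 4 * real N * (real L / 2) \<le> real (card good) * (real L / 2)"
    by (rule mult_right_mono) simp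
  also have "\<dots> \<le> (\<Sum>b\<in>good. real (card (fresh b)))"
    using sum_mono[of good "\<lambda>_. real L / 2" "\<lambda>b. real (card (fresh b))"] fresh_ge by simp
  also have "\<dots> = real (card (Sigma good fresh))"
    using fin by (simp add: card_SigmaI)
  also have "Sigma good fresh = (\<Union>x\<in>\<Lambda>. fiber x)"
    using inside in_range good_lt by (fastforce simp: fiber_def fresh_def)
  also have "real (card \<dots>) \<le> (\<Sum>x\<in>\<Lambda>. real (card (fiber x)))"
    using card_UN_le[OF \<open>finite \<Lambda>\<close>, of fiber] by (metis of_nat_le_iff of_nat_sum)
  also have "\<dots> \<le> (\<Sum>x\<in>\<Lambda>. \<theta> + real m * of_bool (x \<in> heavy_sites \<theta> us))"
  proof (rule sum_mono)
    fix x
    have inj: "inj_on (\<lambda>(b, j). b * L + j) (fiber x)"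
    proof (rule inj_onI, clarify)
      fix b j b' j' assume "(b, j) \<in> fiber x" "(b', j') \<in> fiber x" and eq: "b * L + j = b' * L + j'"
      then have "j < L" "j' < L" by (auto simp: fiber_def fresh_def)
      then have "(b * L + j) div L = b" "(b' * L + j') div L = b'" by auto
      with eq show "b = b' \<and> j = j'" by auto
    qed
    have fin_fiber: "finite (fiber x)"
      by (rule finite_subset[of _ "Sigma good fresh"]) (use fin in \<open>auto simp: fiber_def\<close>)
    show "real (card (fiber x)) \<le> \<theta> + real m * of_bool (x \<in> heavy_sites \<theta> us)"
    proof (cases "x \<in> heavy_sites \<theta> us")
      case False
      have "card (fiber x) = card ((\<lambda>(b, j). b * L + j) ` fiber x)"
        by (rule card_image[OF inj, symmetric])
      also have "\<dots> \<le> visits us x"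
        unfolding visits_def using in_range good_lt len
        by (intro card_mono) (auto simp: fiber_def fresh_def)
      finally show ?thesis using False by (simp add: heavy_sites_def)
    next
      case True
      show ?thesis
      proof (cases "fiber x = {}")
        case True
        then show ?thesis using \<open>\<theta> \<ge> 0\<close> by simp
      next
        case False
        \<comment> \<open>The last block with a fresh visit to the site: the site is not heavy before it.\<close>
        define c where "c = Max (fst ` fiber x)"
        have "c \<in> fst ` fiber x" unfolding c_def using False fin_fiber by (intro Max_in) auto
        then obtain i where ci: "(c, i) \<in> fiber x" by auto
        have c_max: "b \<le> c" if "(b, j) \<in> fiber x" for b j
          unfolding c_def using that fin_fiber by (intro Max_ge) force+
        have c: "c < N" "i < L" "position us (c * L + i) = x" "x \<notin> heavy_sites \<theta> (past c)"
          using ci good_lt by (auto simp: fiber_def fresh_def)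
        have x_blk: "x = sum_list (past c) + position (blk c) i"
          using position_block[OF c(2), of us c] c(3) by (simp add: past_def blk_def)
        have blk_m: "visits (blk c) (position (blk c) i) \<le> m"
          using ci by (auto simp: fiber_def fresh_def)
        define F where "F = {p \<in> fiber x. fst p < c}"
        define G where "G = {j. (c, j) \<in> fiber x}"
        have "card F = card ((\<lambda>(b, j). b * L + j) ` F)"
          by (rule card_image[symmetric], rule inj_on_subset[OF inj]) (auto simp: F_def)
        also have "\<dots> \<le> visits (past c) x"
          unfolding visits_def len_past[OF c(1)]
        proof (rule card_mono)
          show "(\<lambda>(b, j). b * L + j) ` F \<subseteq> {j. j < c * L \<and> position (past c) j = x}"
          proof clarify
            fix b j assume "(b, j) \<in> F"
            then have bj: "b < c" "j < L" "position us (b * L + j) = x"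
              by (auto simp: F_def fiber_def fresh_def)
            have "b * L + j < Suc b * L" using bj by simp
            also have "\<dots> \<le> c * L" using bj by (intro mult_le_mono1) simp
            finally have "b * L + j < c * L" .
            then show "b * L + j < c * L \<and> position (past c) (b * L + j) = x"
              using bj by (simp add: position_def past_def min_def)
          qed
        qed simp
        finally have F: "real (card F) \<le> \<theta>" using c(4) by (simp add: heavy_sites_def)
        have "card G \<le> visits (blk c) (position (blk c) i)"
          unfolding visits_def len_blk[OF c(1)]
        proof (rule card_mono)
          show "G \<subseteq> {j. j < L \<and> position (blk c) j = position (blk c) i}"
          proof
            fix j assume "j \<in> G"
            then have "j < L" "position us (c * L + j) = x" by (auto simp: G_def fiber_def fresh_def)
            then show "j \<in> {j. j < L \<and> position (blk c) j = position (blk c) i}"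
              using position_block[of j L us c] x_blk by (simp add: past_def blk_def)
          qed
        qed simp
        then have G: "card G \<le> m" using blk_m by simp
        have "fiber x \<subseteq> F \<union> Pair c ` G"
          using c_max by (force simp: F_def G_def)
        moreover have fin_G: "finite G"
          by (rule finite_subset[of _ "{..<L}"]) (auto simp: G_def fiber_def fresh_def)
        ultimately have "card (fiber x) \<le> card (F \<union> Pair c ` G)"
          using fin_fiber by (intro card_mono) (auto simp: F_def)
        also have "\<dots> \<le> card F + card (Pair c ` G)" by (rule card_Un_le)
        also have "card (Pair c ` G) \<le> card G" by (rule card_image_le[OF fin_G])
        finally have "real (card (fiber x)) \<le> real (card F) + real (card G)" by linarith
        then show ?thesis using F G True by simp
      qed
    qed
  qed
  also have "\<dots> = \<theta> * real (card \<Lambda>) + real m * real (card (\<Lambda> \<inter> heavy_sites \<theta> us))"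
    unfolding sum.distrib sum_distrib_left[symmetric] using \<open>finite \<Lambda>\<close> by simp
  also have "\<dots> \<le> \<theta> * real (card \<Lambda>) + real m * h"
  proof -
    have "card (\<Lambda> \<inter> heavy_sites \<theta> us) \<le> card (heavy_sites \<theta> us)"
      using assms by (intro card_mono finite_heavy_sites) auto
    then show ?thesis using heavy by (intro add_left_mono mult_left_mono) auto
  qed
  finally show ?thesis by simp
qed

section \<open>Probability of confinement\<close>

definition cube :: "nat \<Rightarrow> (int ^ 3) set" where
  "cube R = {x. \<forall>i. \<bar>x $ i\<bar> < int R}"

lemma all_le_Suc: "(\<forall>k\<le>Suc n. P k) \<longleftrightarrow> P 0 \<and> (\<forall>k\<le>n. P (Suc k))"
  by (metis Suc_le_mono not0_implies_Suc zero_le)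

lemma cos_add_cos_diff: "cos (x + a) + cos (x - a) = 2 * cos a * cos x" for a x :: real
  by (simp add: cos_add cos_diff)

text \<open>
  The product \<open>f\<close> of cosines satisfies \<open>P f = cos a f\<close> on the whole lattice, where \<open>P\<close> averages over
  the neighbours, and it vanishes at the sites where the walk leaves the cube. Hence \<open>f\<close> is an
  eigenfunction of the killed walk, and \<open>f \<le> 1\<close> in the cube.
\<close>
lemma stay_in_cube_ge:
  assumes "R > 0" "y \<in> cube R"
  defines "a \<equiv> pi / (2 * real R)"
  shows "cos a ^ n * (\<Prod>i\<in>UNIV. cos (a * real_of_int (y $ i)))
           \<le> path_mean n (\<lambda>us. of_bool (\<forall>k\<le>n. y + position us k \<in> cube R))"
  using assms(2)
proof (induction n arbitrary: y)
  case 0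
  have "\<bar>\<Prod>i\<in>UNIV. cos (a * real_of_int (y $ i))\<bar> \<le> 1"
    unfolding abs_prod by (intro prod_le_1) auto
  with 0 show ?case by (auto simp: position_def)
next
  case (Suc n)
  define f where "f y = (\<Prod>i\<in>UNIV. cos (a * real_of_int (y $ i)))" for y :: "int ^ 3"
  define g where "g y = path_mean n (\<lambda>us. of_bool (\<forall>k\<le>n. y + position us k \<in> cube R))" for y
  have a: "a * real R = pi / 2" "a > 0" using \<open>R > 0\<close> by (simp_all add: a_def)
  have "a \<le> a * real R" using a \<open>R > 0\<close> by simp
  then have cos_a: "cos a \<ge> 0" using a by (intro cos_ge_zero) auto
  \<comment> \<open>A step out of the cube hits a face, where one of the cosines is zero.\<close>
  have step: "cos a ^ n * f (y + u) \<le> g (y + u)" if u: "u \<in> unit_steps" for u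
  proof (cases "y + u \<in> cube R")
    case True
    then show ?thesis unfolding f_def g_def by (rule Suc.IH)
  next
    case False
    then obtain i where i: "\<bar>(y + u) $ i\<bar> \<ge> int R" by (auto simp: cube_def not_less)
    have "\<bar>u $ i\<bar> \<le> 1" using u by (auto simp: unit_steps_def axis_def)
    moreover have "\<bar>y $ i\<bar> < int R" using Suc.prems by (simp add: cube_def)
    ultimately have "\<bar>(y + u) $ i\<bar> = int R" using i by auto
    then have "\<bar>real_of_int ((y + u) $ i)\<bar> = real R" by linarith
    then have "\<bar>a * real_of_int ((y + u) $ i)\<bar> = pi / 2" using a by (simp add: abs_mult)
    then have "cos (a * real_of_int ((y + u) $ i)) = 0"
      by (metis cos_abs_real cos_pi_half)
    then have "f (y + u) = 0" unfolding f_def by (intro prod_zero) auto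
    moreover have "g (y + u) \<ge> 0" unfolding g_def by (rule path_mean_nonneg) auto
    ultimately show ?thesis by simp
  qed
  have "cos a ^ Suc n * f y = cos a ^ n * (6 * cos a * f y) / 6" by simp
  also have "6 * cos a * f y = (\<Sum>i\<in>UNIV. f (y + axis i 1) + f (y + axis i (- 1)))"
  proof -
    have "f (y + axis i 1) + f (y + axis i (- 1)) = 2 * cos a * f y" for i
    proof -
      have "f (y + axis i s) = cos (a * real_of_int (y $ i) + a * real_of_int s) * (\<Prod>j\<in>UNIV - {i}. cos (a * real_of_int (y $ j)))" for s
        unfolding f_def by (subst prod.remove[of UNIV i]) (auto simp: axis_def algebra_simps intro!: prod.cong)
      moreover have "f y = cos (a * real_of_int (y $ i)) * (\<Prod>j\<in>UNIV - {i}. cos (a * real_of_int (y $ j)))"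
        unfolding f_def by (subst prod.remove[of UNIV i]) auto
      ultimately show ?thesis
        using cos_add_cos_diff[of "a * real_of_int (y $ i)" a] by (simp flip: distrib_right)
    qed
    then show ?thesis by simp
  qed
  also have "\<dots> = (\<Sum>u\<in>unit_steps. f (y + u))" by (rule sum_unit_steps[symmetric])
  also have "cos a ^ n * (\<Sum>u\<in>unit_steps. f (y + u)) / 6 \<le> (\<Sum>u\<in>unit_steps. g (y + u)) / 6"
    unfolding sum_distrib_left using step by (intro divide_right_mono sum_mono) auto
  also have "\<dots> = path_mean (Suc n) (\<lambda>us. of_bool (\<forall>k\<le>Suc n. y + position us k \<in> cube R))"
    using Suc.prems unfolding path_mean_Suc g_def all_le_Suc by (simp add: position_def add.assoc)
  finally show ?case unfolding f_def .
qed

lemma cos_power_ge: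
  fixes a :: real
  assumes "0 \<le> a" "a \<le> 1"
  shows "exp (- a\<^sup>2 * real n) \<le> cos a ^ n"
proof -
  have "exp (- a\<^sup>2) \<le> 1 / (1 + a\<^sup>2)"
    using exp_ge_add_one_self[of "a\<^sup>2"] by (simp add: exp_minus divide_simps add_pos_nonneg)
  also have "\<dots> \<le> 1 - a\<^sup>2 / 2"
  proof -
    have "a\<^sup>2 \<le> 1" using assms by (simp add: power_le_one)
    then have "0 \<le> a\<^sup>2 * (1 - a\<^sup>2)" by simp
    then have "1 \<le> (1 - a\<^sup>2 / 2) * (1 + a\<^sup>2)" by (simp add: algebra_simps)
    then show ?thesis by (simp add: divide_le_eq add_pos_nonneg)
  qed
  also have "\<dots> \<le> cos a"
  proof -
    have "(sin (a / 2))\<^sup>2 \<le> (a / 2)\<^sup>2"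
      using abs_sin_x_le_abs_x[of "a / 2"] by (simp only: abs_le_square_iff)
    moreover have "cos a = 1 - 2 * (sin (a / 2))\<^sup>2" using cos_double_sin[of "a / 2"] by simp
    ultimately show ?thesis by (simp add: power2_eq_square)
  qed
  finally have "exp (- a\<^sup>2) ^ n \<le> cos a ^ n" by (intro power_mono) auto
  then show ?thesis by (simp only: exp_of_nat2_mult)
qed

lemma cube_subset_ball:
  assumes "r > 0" "real R < r / 2 + 1"
  shows "cube R \<subseteq> lattice_ball r"
proof
  fix x assume x: "x \<in> cube R"
  have "\<bar>real_of_int (x $ i)\<bar> \<le> r / 2" for i
  proof -
    have "\<bar>x $ i\<bar> \<le> int R - 1" using x by (simp add: cube_def)
    then have "real_of_int \<bar>x $ i\<bar> \<le> real_of_int (int R - 1)" by (simp only: of_int_le_iff)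
    then show ?thesis using assms by simp
  qed
  then have "(real_of_int (x $ i))\<^sup>2 \<le> (r / 2)\<^sup>2" for i
    by (metis abs_le_square_iff abs_of_nonneg assms(1) half_gt_zero_iff less_imp_le)
  then have "(\<Sum>i\<in>UNIV. (real_of_int (x $ i))\<^sup>2) \<le> (\<Sum>i\<in>(UNIV :: 3 set). (r / 2)\<^sup>2)"
    by (intro sum_mono)
  also have "\<dots> \<le> r\<^sup>2" by (simp add: power2_eq_square)
  finally show "x \<in> lattice_ball r"
    using assms by (simp add: lattice_ball_def norm_vec_def L2_set_def real_le_lsqrt)
qed

text \<open>
  Use a cube of half side about \<open>r / 2\<close>, which fits into the ball because \<open>sqrt 3 / 2 < 1\<close>; the
  eigenvalue is then \<open>cos a\<close> with \<open>a \<le> 4 / r\<close>.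
\<close>
lemma stay_in_ball_ge:
  assumes "r \<ge> 4"
  shows "exp (- 16 * real n / r\<^sup>2) \<le> path_mean n (\<lambda>us. of_bool (\<forall>k\<le>n. position us k \<in> lattice_ball r))"
proof -
  define R where "R = nat \<lceil>r / 2\<rceil>"
  define a where "a = pi / (2 * real R)"
  have R: "r / 2 \<le> real R" "real R < r / 2 + 1" using assms by (auto simp: R_def) linarith
  have "a \<le> 4 / (2 * (r / 2))"
    unfolding a_def using R assms pi_less_4 by (intro frac_le) auto
  then have a: "0 \<le> a" "a \<le> 4 / r" by (simp_all add: a_def)
  moreover have "4 / r \<le> 1" using assms by simp
  ultimately have a1: "a \<le> 1" by linarith
  have "a\<^sup>2 \<le> (4 / r)\<^sup>2" using a by (intro power_mono) auto
  then have "exp (- 16 * real n / r\<^sup>2) \<le> exp (- a\<^sup>2 * real n)"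
    using mult_right_mono[of "a\<^sup>2" "(4 / r)\<^sup>2" "real n"] by (simp add: power_divide)
  also have "\<dots> \<le> cos a ^ n" using a a1 by (intro cos_power_ge)
  also have "\<dots> \<le> path_mean n (\<lambda>us. of_bool (\<forall>k\<le>n. 0 + position us k \<in> cube R))"
    using stay_in_cube_ge[of R 0 n] R assms by (simp add: a_def cube_def)
  also have "\<dots> \<le> path_mean n (\<lambda>us. of_bool (\<forall>k\<le>n. position us k \<in> lattice_ball r))"
    using cube_subset_ball[of r R] R assms by (intro path_mean_mono) auto
  finally show ?thesis .
qed

section \<open>Volume of lattice balls\<close>

lemma lattice_ball_subset_box:
  "lattice_ball r \<subseteq> {x :: int ^ 3. \<forall>i. x $ i \<in> {- \<lfloor>r\<rfloor>..\<lfloor>r\<rfloor>}}"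
proof
  fix x :: "int ^ 3" assume "x \<in> lattice_ball r"
  then have "norm (\<chi> i. real_of_int (x $ i)) \<le> r" by (simp add: lattice_ball_def)
  then have "\<bar>real_of_int (x $ i)\<bar> \<le> r" for i
    using component_le_norm_cart[of "\<chi> i. real_of_int (x $ i)" i] by simp
  then have "x $ i \<le> \<lfloor>r\<rfloor>" "- (x $ i) \<le> \<lfloor>r\<rfloor>" for i
    unfolding le_floor_iff by (auto simp: abs_le_iff)
  then have "x $ i \<in> {- \<lfloor>r\<rfloor>..\<lfloor>r\<rfloor>}" for i
    by (metis atLeastAtMost_iff minus_le_iff)
  then show "x \<in> {x. \<forall>i. x $ i \<in> {- \<lfloor>r\<rfloor>..\<lfloor>r\<rfloor>}}" by simp
qed

lemma box_eq_image:
  "{x :: int ^ 3. \<forall>i. x $ i \<in> I} = (\<lambda>(a, b, c). vector [a, b, c]) ` (I \<times> I \<times> I)"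
proof (intro equalityI subsetI)
  fix x :: "int ^ 3" assume "x \<in> {x. \<forall>i. x $ i \<in> I}"
  moreover have "x = vector [x $ 1, x $ 2, x $ 3]" by (simp add: vec_eq_iff forall_3 vector_3)
  ultimately show "x \<in> (\<lambda>(a, b, c). vector [a, b, c]) ` (I \<times> I \<times> I)"
    by (intro image_eqI[of _ _ "(x $ 1, x $ 2, x $ 3)"]) auto
qed (auto simp: forall_3 vector_3)

lemma finite_lattice_ball: "finite (lattice_ball r :: (int ^ 3) set)"
  by (rule finite_subset[OF lattice_ball_subset_box]) (subst box_eq_image, simp)

lemma card_lattice_ball_le:
  assumes "r \<ge> 1"
  shows "real (card (lattice_ball r :: (int ^ 3) set)) \<le> 27 * r ^ 3"
proof -
  define I where "I = {- \<lfloor>r\<rfloor>..\<lfloor>r\<rfloor>}"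
  have "card (lattice_ball r :: (int ^ 3) set) \<le> card {x :: int ^ 3. \<forall>i. x $ i \<in> I}"
    unfolding I_def by (rule card_mono[OF _ lattice_ball_subset_box]) (subst box_eq_image, simp)
  also have "\<dots> \<le> card (I \<times> I \<times> I)"
    unfolding box_eq_image by (rule card_image_le) (simp add: I_def)
  also have "\<dots> = card I ^ 3" by (simp add: card_cartesian_product power3_eq_cube)
  finally have "real (card (lattice_ball r :: (int ^ 3) set)) \<le> real (card I) ^ 3"
    by (metis of_nat_le_iff of_nat_power)
  also have "real (card I) \<le> 3 * r"
  proof -
    have "real (card I) = real_of_int (2 * \<lfloor>r\<rfloor> + 1)" using assms by (simp add: I_def)
    also have "\<dots> \<le> 3 * r" using assms by simp linarith
    finally show ?thesis .
  qed
  then have "real (card I) ^ 3 \<le> (3 * r) ^ 3" by (intro power_mono) auto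
  finally show ?thesis by (simp add: power_mult_distrib)
qed

lemma card_lattice_ball_pos:
  assumes "r \<ge> 0"
  shows "card (lattice_ball r :: (int ^ 3) set) > 0"
proof -
  have "(0 :: int ^ 3) \<in> lattice_ball r" using assms by (simp add: lattice_ball_def norm_vec_def L2_set_def)
  then show ?thesis using finite_lattice_ball[of r] by (auto simp: card_gt_0_iff)
qed

section \<open>From step sequences to the random walk\<close>

definition increments :: "(nat \<Rightarrow> 'w \<Rightarrow> int ^ 3) \<Rightarrow> nat \<Rightarrow> 'w \<Rightarrow> (int ^ 3) list" where
  "increments S n \<omega> = map (\<lambda>k. S (Suc k) \<omega> - S k \<omega>) [0..<n]"

lemma length_increments [simp]: "length (increments S n \<omega>) = n"
  by (simp add: increments_def)

lemma increments_eq_iff: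
  "increments S n \<omega> = us \<longleftrightarrow> length us = n \<and> (\<forall>k<n. S (Suc k) \<omega> - S k \<omega> = us ! k)"
proof -
  have "\<forall>k<n. increments S n \<omega> ! k = S (Suc k) \<omega> - S k \<omega>" by (simp add: increments_def)
  then show ?thesis unfolding list_eq_iff_nth_eq length_increments by auto
qed

lemma position_increments:
  assumes "S 0 \<omega> = 0" "k \<le> n"
  shows "position (increments S n \<omega>) k = S k \<omega>"
  using assms(2)
proof (induction k)
  case 0
  then show ?case using assms(1) by (simp add: position_def)
next
  case (Suc k)
  then have "position (increments S n \<omega>) (Suc k) = position (increments S n \<omega>) k + (S (Suc k) \<omega> - S k \<omega>)"
    unfolding position_def by (subst take_Suc_conv_app_nth) (simp_all add: increments_def)
  also have "position (increments S n \<omega>) k = S k \<omega>" using Suc.prems by (intro Suc.IH) simp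
  finally show ?case by simp
qed

context
  fixes M :: "'w measure" and S :: "nat \<Rightarrow> 'w \<Rightarrow> int ^ 3"
  assumes srw: "simple_random_walk M S"
begin

interpretation simple_random_walk M S by (rule srw)

lemma increments_measurable: "increments S n \<in> measurable M (count_space UNIV)"
proof -
  have "increments S n -` {us} \<inter> space M \<in> sets M" for us
  proof -
    have "increments S n -` {us} \<inter> space M = {\<omega> \<in> space M. increments S n \<omega> = us}"
      by blast
    also have "\<dots> = {\<omega> \<in> space M. length us = n \<and> (\<forall>k\<in>{..<n}. S (Suc k) \<omega> - S k \<omega> = us ! k)}"
      unfolding increments_eq_iff Ball_def lessThan_iff ..
    also have "\<dots> \<in> sets M"
    proof -
      have step: "{\<omega> \<in> space M. S (Suc k) \<omega> - S k \<omega> = us ! k} \<in> sets M" for k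
      proof -
        have "random_variable (count_space UNIV) (\<lambda>\<omega>. S (Suc k) \<omega> - S k \<omega>)"
          using indep_increments by (auto simp: indep_vars_def)
        from measurable_sets[OF this, of "{us ! k}"]
        have "(\<lambda>\<omega>. S (Suc k) \<omega> - S k \<omega>) -` {us ! k} \<inter> space M \<in> sets M" by simp
        also have "(\<lambda>\<omega>. S (Suc k) \<omega> - S k \<omega>) -` {us ! k} \<inter> space M = {\<omega> \<in> space M. S (Suc k) \<omega> - S k \<omega> = us ! k}"
          by auto
        finally show ?thesis .
      qed
      have "{\<omega> \<in> space M. \<forall>k\<in>{..<n}. S (Suc k) \<omega> - S k \<omega> = us ! k} \<in> sets M"
        by (rule sets.sets_Collect_finite_All[OF step finite_lessThan])
      then show ?thesis by (cases "length us = n") simp_all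
    qed
    finally show ?thesis .
  qed
  then show ?thesis by (subst measurable_count_space_eq_countable) auto
qed

lemma increments_event: "{\<omega> \<in> space M. P (increments S n \<omega>)} \<in> sets M"
proof -
  have "increments S n -` Collect P \<inter> space M \<in> sets M"
    by (rule measurable_sets[OF increments_measurable]) simp
  also have "increments S n -` Collect P \<inter> space M = {\<omega> \<in> space M. P (increments S n \<omega>)}" by auto
  finally show ?thesis .
qed

lemma prob_increments_eq:
  assumes "us \<in> step_lists n"
  shows "prob {\<omega> \<in> space M. increments S n \<omega> = us} = (1 / 6) ^ n"
proof -
  define X where "X k \<omega> = S (Suc k) \<omega> - S k \<omega>" for k \<omega>
  have len: "length us = n" using assms by (rule length_step_lists)
  have us: "us ! k \<in> unit_steps" if "k < n" for k
    using assms nth_mem[of k us] that len unfolding step_lists_def by blast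
  have X: "indep_vars (\<lambda>_. count_space UNIV) X UNIV"
    unfolding X_def[abs_def] by (rule indep_increments)
  have "prob (X k -` {us ! k} \<inter> space M) = 1 / 6" if "k < n" for k
  proof -
    have "prob (X k -` {us ! k} \<inter> space M) = measure (distr M (count_space UNIV) (X k)) {us ! k}"
      using X by (subst measure_distr) (auto simp: indep_vars_def)
    also have "\<dots> = pmf (pmf_of_set unit_steps) (us ! k)"
      using distr_increment[of k] by (simp add: X_def[abs_def] pmf.rep_eq)
    also have "\<dots> = 1 / 6"
    proof -
      have "(unit_steps :: (int ^ 3) set) \<noteq> {}" using card_unit_steps by auto
      then show ?thesis using us[OF that] by (simp add: pmf_of_set card_unit_steps)
    qed
    finally show ?thesis .
  qed
  note X_prob = this
  show ?thesis
  proof (cases "n = 0")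
    case True
    then have "{\<omega> \<in> space M. increments S n \<omega> = us} = space M"
      using len by (auto simp: increments_def)
    then show ?thesis using True by (simp add: prob_space)
  next
    case False
    then have "{\<omega> \<in> space M. increments S n \<omega> = us} = (\<Inter>k\<in>{..<n}. X k -` {us ! k} \<inter> space M)"
      unfolding increments_eq_iff X_def using len by blast
    also have "prob \<dots> = (\<Prod>k<n. prob (X k -` {us ! k} \<inter> space M))"
      using X False by (intro indep_varsD[where M' = "\<lambda>_. count_space UNIV" and I = UNIV]) auto
    also have "\<dots> = (\<Prod>k<n. 1 / 6)" using X_prob by (intro prod.cong) auto
    finally show ?thesis by simp
  qed
qed

text \<open>
  Each sequence of unit steps has probability \<open>6\<close> to the power \<open>- n\<close>, which gives the lower bound for every
  event. Applied to the complement as well, it gives equality, without a separate proof that the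
  increments almost surely are unit steps.
\<close>
lemma prob_increments:
  "prob {\<omega> \<in> space M. P (increments S n \<omega>)} = path_mean n (\<lambda>us. of_bool (P us))"
proof -
  have ge: "path_mean n (\<lambda>us. of_bool (Q us)) \<le> prob {\<omega> \<in> space M. Q (increments S n \<omega>)}" for Q
  proof -
    have fin: "finite {us \<in> step_lists n. Q us}" by simp
    have "path_mean n (\<lambda>us. of_bool (Q us)) = (\<Sum>us\<in>{us \<in> step_lists n. Q us}. (1 / 6) ^ n)"
    proof -
      have "(\<Sum>us\<in>step_lists n. of_bool (Q us)) = (\<Sum>us\<in>{us \<in> step_lists n. Q us}. 1 :: real)"
        by (rule sum.mono_neutral_cong_right) auto
      then show ?thesis
        unfolding path_mean_def by (simp only: sum_divide_distrib power_one_over)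
    qed
    also have "\<dots> = (\<Sum>us\<in>{us \<in> step_lists n. Q us}. prob {\<omega> \<in> space M. increments S n \<omega> = us})"
      by (intro sum.cong) (auto simp: prob_increments_eq)
    also have "\<dots> = prob (\<Union>us\<in>{us \<in> step_lists n. Q us}. {\<omega> \<in> space M. increments S n \<omega> = us})"
      using increments_event
      by (intro finite_measure_finite_Union[symmetric] fin) (auto simp: disjoint_family_on_def)
    also have "\<dots> \<le> prob {\<omega> \<in> space M. Q (increments S n \<omega>)}"
      by (intro finite_measure_mono increments_event) auto
    finally show ?thesis .
  qed
  have "path_mean n (\<lambda>us. of_bool (P us)) + path_mean n (\<lambda>us. of_bool (\<not> P us)) = path_mean n (\<lambda>us. 1)"
    unfolding path_mean_plus[symmetric] by (intro path_mean_cong) auto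
  moreover have "prob {\<omega> \<in> space M. \<not> P (increments S n \<omega>)} = 1 - prob {\<omega> \<in> space M. P (increments S n \<omega>)}"
    by (intro prob_neg increments_event)
  ultimately show ?thesis using ge[of P] ge[of "\<lambda>us. \<not> P us"] by simp
qed

end

lemma less_exit_time_iff:
  "enat n < exit_time S r \<omega> \<longleftrightarrow> (\<forall>k\<le>n. S k \<omega> \<in> lattice_ball r)"
proof
  assume *: "enat n < exit_time S r \<omega>"
  show "\<forall>k\<le>n. S k \<omega> \<in> lattice_ball r"
  proof (intro allI impI, rule ccontr)
    fix k assume "k \<le> n" "S k \<omega> \<notin> lattice_ball r"
    then have "exit_time S r \<omega> \<le> enat k" unfolding exit_time_def by (intro Inf_lower) auto
    also have "\<dots> \<le> enat n" using \<open>k \<le> n\<close> by simp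
    finally show False using * by simp
  qed
next
  assume *: "\<forall>k\<le>n. S k \<omega> \<in> lattice_ball r"
  have "enat (Suc n) \<le> exit_time S r \<omega>"
    unfolding exit_time_def
  proof (rule Inf_greatest)
    fix t assume "t \<in> {enat k |k. S k \<omega> \<notin> lattice_ball r}"
    then obtain k where "t = enat k" "S k \<omega> \<notin> lattice_ball r" by blast
    then show "enat (Suc n) \<le> t" using * by (auto simp: not_less_eq_eq)
  qed
  then show "enat n < exit_time S r \<omega>" by (rule less_le_trans[rotated]) simp
qed

lemma local_time_eq_card: "local_time S n x \<omega> = card {k. k \<le> n \<and> S k \<omega> = x}"
proof -
  have "{0..n} \<inter> {k. S k \<omega> = x} = {k. k \<le> n \<and> S k \<omega> = x}" by auto
  then show ?thesis by (simp add: local_time_def)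
qed

lemma finite_local_time_gt:
  assumes "\<theta> \<ge> 0"
  shows "finite {x. real (local_time S n x \<omega>) > \<theta>}"
proof (rule finite_subset)
  show "{x. real (local_time S n x \<omega>) > \<theta>} \<subseteq> (\<lambda>k. S k \<omega>) ` {..n}"
  proof
    fix x assume "x \<in> {x. real (local_time S n x \<omega>) > \<theta>}"
    then have "local_time S n x \<omega> \<noteq> 0" using assms by auto
    then have "{k. k \<le> n \<and> S k \<omega> = x} \<noteq> {}" unfolding local_time_eq_card by (metis card.empty)
    then show "x \<in> (\<lambda>k. S k \<omega>) ` {..n}" by auto
  qed
qed simp

lemma heavy_sites_subset_local_time:
  assumes "S 0 \<omega> = 0" "k \<le> n"
  shows "heavy_sites \<theta> (increments S k \<omega>) \<subseteq> {x. real (local_time S n x \<omega>) > \<theta>}"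
proof
  fix x assume x: "x \<in> heavy_sites \<theta> (increments S k \<omega>)"
  have "visits (increments S k \<omega>) x \<le> local_time S n x \<omega>"
    unfolding visits_def local_time_eq_card length_increments
    using assms position_increments[of S \<omega>, OF assms(1)] by (intro card_mono) auto
  then show "x \<in> {x. real (local_time S n x \<omega>) > \<theta>}"
    using x unfolding heavy_sites_def mem_Collect_eq by linarith
qed

text \<open>
  By \<open>small\<close> and \<open>occupation_le_of_few_bad_blocks\<close>, at least a quarter of the blocks must be bad.
  Sites that are heavy for the first \<open>N * L\<close> steps are heavy for the whole path.
\<close>
lemma prob_confined_with_few_heavy_sites_le:
  fixes S :: "nat \<Rightarrow> 'w \<Rightarrow> int ^ 3"
  assumes srw: "simple_random_walk M S"
    and pos: "L > 0" "m > 0" "\<theta> \<ge> 0" "c \<ge> 0" "K \<ge> 0"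
    and h: "h \<le> c ^ 3"
    and N: "N * L \<le> n"
    and rare: "16 * c / sqrt (real L) + 64 * return_constant / real m \<le> exp (- 4 * K)"
    and small: "\<theta> * real (card (lattice_ball r :: (int ^ 3) set)) + real m * h < 3 / 8 * real (N * L)"
  shows "measure M {\<omega> \<in> space M. (\<forall>k\<le>n. S k \<omega> \<in> lattice_ball r)
             \<and> \<not> real (card {x. real (local_time S n x \<omega>) > \<theta>}) \<ge> h} \<le> (2 * exp (- K)) ^ N"
proof -
  interpret simple_random_walk M S by (rule srw)
  define B where "B = bad_block \<theta> h m"
  have "{\<omega> \<in> space M. (\<forall>k\<le>n. S k \<omega> \<in> lattice_ball r)
             \<and> \<not> real (card {x. real (local_time S n x \<omega>) > \<theta>}) \<ge> h}
      \<subseteq> {\<omega> \<in> space M. N \<le> 4 * card (bad_indices B L N (increments S (N * L) \<omega>))}"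
  proof (intro Collect_mono impI conjI, elim conjE, assumption, elim conjE)
    fix \<omega> assume \<omega>: "\<omega> \<in> space M" and inside: "\<forall>k\<le>n. S k \<omega> \<in> lattice_ball r"
      and few: "\<not> real (card {x. real (local_time S n x \<omega>) > \<theta>}) \<ge> h"
    define us where "us = increments S (N * L) \<omega>"
    note S0 = start_at_origin[OF \<omega>]
    have "card (heavy_sites \<theta> us) \<le> card {x. real (local_time S n x \<omega>) > \<theta>}"
      unfolding us_def using pos by (intro card_mono finite_local_time_gt heavy_sites_subset_local_time S0 N) auto
    then have "real (card (heavy_sites \<theta> us)) \<le> h" using few by linarith
    moreover have "position us j \<in> lattice_ball r" if "j < N * L" for j
      using that inside N unfolding us_def by (subst position_increments[of S \<omega>, OF S0]) auto
    ultimately show "N \<le> 4 * card (bad_indices B L N (increments S (N * L) \<omega>))"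
      using occupation_le_of_few_bad_blocks[of us N L \<theta> "lattice_ball r" h m] pos small
      unfolding B_def us_def[symmetric] by (force simp: us_def finite_lattice_ball)
  qed
  then have "measure M {\<omega> \<in> space M. (\<forall>k\<le>n. S k \<omega> \<in> lattice_ball r)
             \<and> \<not> real (card {x. real (local_time S n x \<omega>) > \<theta>}) \<ge> h}
      \<le> prob {\<omega> \<in> space M. N \<le> 4 * card (bad_indices B L N (increments S (N * L) \<omega>))}"
    by (intro finite_measure_mono increments_event[OF srw])
  also have "\<dots> = path_mean (N * L) (\<lambda>us. of_bool (N \<le> 4 * card (bad_indices B L N us)))"
    by (rule prob_increments[OF srw])
  also have "\<dots> \<le> (2 * exp (- K)) ^ N"
  proof (rule many_bad_blocks_le)
    show "path_mean L (\<lambda>vs. of_bool (B us vs)) \<le> exp (- 4 * K)" for us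
      unfolding B_def using bad_block_mean_le[OF pos(3) pos(4) h pos(2) pos(1), of us] rare by linarith
  qed (rule pos)
  finally show ?thesis .
qed

text \<open>
  Given confinement, the complementary event has probability at most \<open>b / a\<close>. Events and condition
  are determined by the first \<open>n\<close> increments, which makes them measurable.
\<close>
lemma cond_prob_ge:
  fixes S :: "nat \<Rightarrow> 'w \<Rightarrow> int ^ 3"
  assumes srw: "simple_random_walk M S"
    and few: "measure M {\<omega> \<in> space M. (\<forall>k\<le>n. S k \<omega> \<in> lattice_ball r)
             \<and> \<not> real (card {x. real (local_time S n x \<omega>) > \<theta>}) \<ge> h} \<le> b"
    and stay: "a \<le> path_mean n (\<lambda>us. of_bool (\<forall>k\<le>n. position us k \<in> lattice_ball r))" "a > 0"
  shows "1 - b / a \<le> \<P>(\<omega> in M. real (card {x. real (local_time S n x \<omega>) > \<theta>}) \<ge> h \<bar> exit_time S r \<omega> > enat n)"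
    and "\<P>(\<omega> in M. real (card {x. real (local_time S n x \<omega>) > \<theta>}) \<ge> h \<bar> exit_time S r \<omega> > enat n) \<le> 1"
proof -
  interpret simple_random_walk M S by (rule srw)
  define P where "P \<omega> \<longleftrightarrow> real (card {x. real (local_time S n x \<omega>) > \<theta>}) \<ge> h" for \<omega>
  define Q where "Q \<omega> \<longleftrightarrow> (\<forall>k\<le>n. S k \<omega> \<in> lattice_ball r)" for \<omega>
  define P' where "P' us \<longleftrightarrow> real (card {x. real (card {k. k \<le> n \<and> position us k = x}) > \<theta>}) \<ge> h" for us
  define Q' where "Q' us \<longleftrightarrow> (\<forall>k\<le>n. position us k \<in> lattice_ball r)" for us
  have pos_eq: "position (increments S n \<omega>) k = S k \<omega>" if "\<omega> \<in> space M" "k \<le> n" for \<omega> k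
    using that start_at_origin by (intro position_increments)
  have P: "P \<omega> = P' (increments S n \<omega>)" if "\<omega> \<in> space M" for \<omega>
    unfolding P_def P'_def local_time_eq_card using pos_eq[OF that] by (simp cong: conj_cong)
  have Q: "Q \<omega> = Q' (increments S n \<omega>)" if "\<omega> \<in> space M" for \<omega>
    unfolding Q_def Q'_def using pos_eq[OF that] by simp
  have "{\<omega> \<in> space M. P \<omega> \<and> Q \<omega>} = {\<omega> \<in> space M. P' (increments S n \<omega>) \<and> Q' (increments S n \<omega>)}"
    using P Q by auto
  then have PQ: "{\<omega> \<in> space M. P \<omega> \<and> Q \<omega>} \<in> events"
    using increments_event[OF srw, of "\<lambda>us. P' us \<and> Q' us" n] by simp
  have "{\<omega> \<in> space M. Q \<omega> \<and> \<not> P \<omega>} = {\<omega> \<in> space M. Q' (increments S n \<omega>) \<and> \<not> P' (increments S n \<omega>)}"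
    using P Q by auto
  then have QnP: "{\<omega> \<in> space M. Q \<omega> \<and> \<not> P \<omega>} \<in> events"
    using increments_event[OF srw, of "\<lambda>us. Q' us \<and> \<not> P' us" n] by simp
  have "{\<omega> \<in> space M. Q \<omega>} = {\<omega> \<in> space M. Q' (increments S n \<omega>)}" using Q by auto
  then have "prob {\<omega> \<in> space M. Q \<omega>} = path_mean n (\<lambda>us. of_bool (Q' us))"
    using prob_increments[OF srw, of Q' n] by simp
  then have a: "a \<le> prob {\<omega> \<in> space M. Q \<omega>}" using stay(1) by (simp add: Q'_def)
  have split: "{\<omega> \<in> space M. Q \<omega>} = {\<omega> \<in> space M. P \<omega> \<and> Q \<omega>} \<union> {\<omega> \<in> space M. Q \<omega> \<and> \<not> P \<omega>}" by auto
  have sum: "prob {\<omega> \<in> space M. Q \<omega>} = prob {\<omega> \<in> space M. P \<omega> \<and> Q \<omega>} + prob {\<omega> \<in> space M. Q \<omega> \<and> \<not> P \<omega>}"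
    unfolding split by (intro finite_measure_Union PQ QnP) auto
  have b: "prob {\<omega> \<in> space M. Q \<omega> \<and> \<not> P \<omega>} \<le> b" using few by (simp add: P_def Q_def)
  have cond: "\<P>(\<omega> in M. real (card {x. real (local_time S n x \<omega>) > \<theta>}) \<ge> h \<bar> exit_time S r \<omega> > enat n)
      = prob {\<omega> \<in> space M. P \<omega> \<and> Q \<omega>} / prob {\<omega> \<in> space M. Q \<omega>}"
    unfolding cond_prob_def less_exit_time_iff P_def Q_def ..
  define q where "q = prob {\<omega> \<in> space M. Q \<omega>}"
  define z where "z = prob {\<omega> \<in> space M. Q \<omega> \<and> \<not> P \<omega>}"
  have qz: "a \<le> q" "z \<le> b" "0 \<le> z" using a b by (auto simp: q_def z_def)
  have "z / q \<le> b / a" using qz stay(2) by (intro frac_le) auto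
  moreover have "prob {\<omega> \<in> space M. P \<omega> \<and> Q \<omega>} / q = 1 - z / q"
    using sum qz stay(2) unfolding q_def[symmetric] z_def[symmetric] by (simp add: field_simps)
  moreover have "0 \<le> z / q" using qz stay(2) by simp
  ultimately show "1 - b / a \<le> \<P>(\<omega> in M. real (card {x. real (local_time S n x \<omega>) > \<theta>}) \<ge> h \<bar> exit_time S r \<omega> > enat n)"
    and "\<P>(\<omega> in M. real (card {x. real (local_time S n x \<omega>) > \<theta>}) \<ge> h \<bar> exit_time S r \<omega> > enat n) \<le> 1"
    unfolding cond q_def[symmetric] by linarith+
qed

section \<open>Heavy sites under confinement\<close>

definition block_length :: "real \<Rightarrow> nat" where
  "block_length r = nat \<lceil>r\<^sup>2\<rceil>"

lemma block_length_bounds: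
  assumes "r \<ge> 1"
  shows "r\<^sup>2 \<le> real (block_length r)" "real (block_length r) \<le> 2 * r\<^sup>2" "block_length r > 0"
proof -
  have "1 \<le> r\<^sup>2" using assms by (simp add: one_le_power)
  moreover have "real (block_length r) = real_of_int \<lceil>r\<^sup>2\<rceil>" unfolding block_length_def by simp
  moreover have "r\<^sup>2 \<le> real_of_int \<lceil>r\<^sup>2\<rceil>" "real_of_int \<lceil>r\<^sup>2\<rceil> < r\<^sup>2 + 1" by linarith+
  ultimately show "r\<^sup>2 \<le> real (block_length r)" "real (block_length r) \<le> 2 * r\<^sup>2" "block_length r > 0"
    by linarith+
qed

text \<open>
  Confinement has probability at least \<open>exp (- 16 n / r\<^sup>2) \<ge> exp (- 32 (N + 1))\<close>, because \<open>n < (N + 1) L\<close> and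
  \<open>L \<le> 2 r\<^sup>2\<close>. The choice \<open>K = 36\<close> in the bound for the bad blocks beats this by a factor
  \<open>2 exp (- 4) < 2/5\<close> per block, and it requires that a block is bad with probability at most
  \<open>exp (- 4 K) = exp (- 144)\<close>; half of this is allotted to each of the two ways of being bad. The two
  conditions on \<open>27 * \<epsilon>\<^sub>0\<close> come from \<open>|B(r)| \<le> 27 r\<^sup>3\<close>.
\<close>
lemma cond_prob_heavy_ge:
  fixes S :: "nat \<Rightarrow> 'w \<Rightarrow> int ^ 3" and \<epsilon>\<^sub>0 \<delta>\<^sub>0 r A :: real
  assumes srw: "simple_random_walk M S"
    and r: "r \<ge> 4" and n: "r ^ 3 \<le> A * real n" and A: "A > 0"
    and m: "m > 0" "64 * return_constant / real m \<le> exp (- 144) / 2"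
    and \<epsilon>: "0 < \<epsilon>\<^sub>0" "27 * \<epsilon>\<^sub>0 \<le> (exp (- 144) / 32) ^ 3" "27 * \<epsilon>\<^sub>0 * A * real m \<le> 1 / 16"
    and \<delta>: "0 < \<delta>\<^sub>0" "\<delta>\<^sub>0 \<le> 1 / 16"
    and N_def: "N = n div block_length r" and N: "N \<ge> 1"
  defines "b \<equiv> real (card (lattice_ball r :: (int ^ 3) set))"
  shows "1 - exp 32 * (2 / 5) ^ N \<le> \<P>(\<omega> in M. real (card {x. real (local_time S n x \<omega>) > \<delta>\<^sub>0 * (real n / b)}) \<ge> \<epsilon>\<^sub>0 * b \<bar> exit_time S r \<omega> > enat n)"
    and "\<P>(\<omega> in M. real (card {x. real (local_time S n x \<omega>) > \<delta>\<^sub>0 * (real n / b)}) \<ge> \<epsilon>\<^sub>0 * b \<bar> exit_time S r \<omega> > enat n) \<le> 1"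
proof -
  define L where "L = block_length r"
  define c where "c = exp (- 144) / 32 * sqrt (real L)"
  have L: "r\<^sup>2 \<le> real L" "real L \<le> 2 * r\<^sup>2" "L > 0"
    using block_length_bounds[of r] r by (simp_all add: L_def)
  have b: "b > 0" "b \<le> 27 * r ^ 3"
    using card_lattice_ball_pos[of r] card_lattice_ball_le[of r] r by (simp_all add: b_def)
  have NL: "N * L \<le> n" "n < Suc N * L"
    using div_times_less_eq_dividend[of n L] dividend_less_div_times[of L n] L(3)
    by (simp_all add: N_def L_def add.commute)
  then have n2: "real n < 2 * real (N * L)"
  proof -
    have "Suc N * L \<le> 2 * (N * L)" using N by simp
    then show ?thesis using NL(2) by linarith
  qed
  have "r \<le> sqrt (real L)" using L(1) r by (intro real_le_rsqrt) auto
  have "\<epsilon>\<^sub>0 * b \<le> \<epsilon>\<^sub>0 * (27 * r ^ 3)" using b \<epsilon> by (intro mult_left_mono) auto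
  also have "\<dots> = (27 * \<epsilon>\<^sub>0) * r ^ 3" by simp
  also have "\<dots> \<le> (exp (- 144) / 32) ^ 3 * sqrt (real L) ^ 3"
    using \<epsilon> r \<open>r \<le> sqrt (real L)\<close> by (intro mult_mono power_mono) auto
  finally have h: "\<epsilon>\<^sub>0 * b \<le> c ^ 3" by (simp only: c_def power_mult_distrib)
  have "16 * c / sqrt (real L) = exp (- 144) / 2" using L by (simp add: c_def)
  then have rare: "16 * c / sqrt (real L) + 64 * return_constant / real m \<le> exp (- 4 * 36)"
    using m by simp
  have "\<delta>\<^sub>0 * (real n / b) * b = \<delta>\<^sub>0 * real n" using b by simp
  also have "\<dots> \<le> 1 / 16 * real n" using \<delta> by (intro mult_right_mono) auto
  finally have heavy: "\<delta>\<^sub>0 * (real n / b) * b \<le> real n / 16" by simp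
  have "real m * (\<epsilon>\<^sub>0 * b) \<le> real m * (\<epsilon>\<^sub>0 * (27 * (A * real n)))"
    using b n \<epsilon> by (intro mult_left_mono) auto
  also have "\<dots> = (27 * \<epsilon>\<^sub>0 * A * real m) * real n" by simp
  also have "\<dots> \<le> 1 / 16 * real n" using \<epsilon> by (intro mult_right_mono) auto
  finally have "\<delta>\<^sub>0 * (real n / b) * b + real m * (\<epsilon>\<^sub>0 * b) \<le> real n / 8" using heavy by simp
  also have "\<dots> < 3 / 8 * real (N * L)" using n2 L N by simp
  finally have small: "\<delta>\<^sub>0 * (real n / b) * real (card (lattice_ball r :: (int ^ 3) set)) + real m * (\<epsilon>\<^sub>0 * b)
      < 3 / 8 * real (N * L)"
    by (fold b_def)
  have few: "measure M {\<omega> \<in> space M. (\<forall>k\<le>n. S k \<omega> \<in> lattice_ball r)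
             \<and> \<not> real (card {x. real (local_time S n x \<omega>) > \<delta>\<^sub>0 * (real n / b)}) \<ge> \<epsilon>\<^sub>0 * b} \<le> (2 * exp (- 36)) ^ N"
    by (rule prob_confined_with_few_heavy_sites_le[OF srw L(3) m(1) _ _ _ h NL(1) rare small])
      (use b \<delta> in \<open>auto simp: c_def\<close>)
  have "exp (- 32 * (real N + 1)) \<le> exp (- 16 * real n / r\<^sup>2)"
  proof -
    have "real n \<le> real (Suc N * L)" using NL(2) by linarith
    also have "\<dots> = (real N + 1) * real L" by (simp add: algebra_simps)
    also have "\<dots> \<le> (real N + 1) * (2 * r\<^sup>2)" using L by (intro mult_left_mono) auto
    finally have "real n / r\<^sup>2 \<le> 2 * (real N + 1)" using r by (simp add: divide_le_eq algebra_simps)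
    then show ?thesis by simp
  qed
  also have "\<dots> \<le> path_mean n (\<lambda>us. of_bool (\<forall>k\<le>n. position us k \<in> lattice_ball r))"
    using r by (rule stay_in_ball_ge)
  finally have stay: "exp (- 32 * (real N + 1)) \<le> path_mean n (\<lambda>us. of_bool (\<forall>k\<le>n. position us k \<in> lattice_ball r))" .
  have "(2 * exp (- 36)) ^ N / exp (- 32 * (real N + 1)) = exp 32 * (2 * exp (- 4 :: real)) ^ N"
  proof -
    have "exp (- 36 :: real) = exp (- 4) * exp (- 32)" by (simp flip: exp_add)
    moreover have "exp (- 32 * (real N + 1)) = exp (- 32 :: real) ^ N * exp (- 32)"
      by (simp add: exp_of_nat2_mult[symmetric] algebra_simps flip: exp_add)
    moreover have "exp (32 :: real) * exp (- 32) = 1" by (simp flip: exp_add)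
    ultimately show ?thesis by (simp add: power_mult_distrib field_simps)
  qed
  also have "\<dots> \<le> exp 32 * (2 / 5) ^ N"
  proof -
    have "(5 :: real) \<le> exp 4" using exp_ge_add_one_self[of 4] by simp
    then have "2 * exp (- 4 :: real) \<le> 2 / 5" by (simp add: exp_minus divide_simps)
    then show ?thesis by (intro mult_left_mono power_mono) auto
  qed
  finally have ratio: "(2 * exp (- 36)) ^ N / exp (- 32 * (real N + 1)) \<le> exp 32 * (2 / 5) ^ N" .
  show "1 - exp 32 * (2 / 5) ^ N \<le> \<P>(\<omega> in M. real (card {x. real (local_time S n x \<omega>) > \<delta>\<^sub>0 * (real n / b)}) \<ge> \<epsilon>\<^sub>0 * b \<bar> exit_time S r \<omega> > enat n)"
    using cond_prob_ge(1)[OF srw few stay exp_gt_zero] ratio by linarith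
  show "\<P>(\<omega> in M. real (card {x. real (local_time S n x \<omega>) > \<delta>\<^sub>0 * (real n / b)}) \<ge> \<epsilon>\<^sub>0 * b \<bar> exit_time S r \<omega> > enat n) \<le> 1"
    by (rule cond_prob_ge(2)[OF srw few stay exp_gt_zero])
qed

text \<open>
  The number of blocks is of order \<open>n / r\<^sup>2 \<ge> r / A\<close>.
\<close>
lemma block_count_at_top:
  assumes r: "filterlim r at_top sequentially" and n: "\<forall>n\<ge>1. r n ^ 3 \<le> A * real n" and A: "A > 0"
  shows "filterlim (\<lambda>n. n div block_length (r n)) at_top sequentially"
  unfolding filterlim_at_top
proof
  fix Z :: nat
  have "eventually (\<lambda>n. max 1 (2 * A * (real Z + 1)) \<le> r n) sequentially"
    using r unfolding filterlim_at_top by blast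
  then show "eventually (\<lambda>n. Z \<le> n div block_length (r n)) sequentially"
    using eventually_ge_at_top[of 1]
  proof eventually_elim
    case (elim n)
    define L where "L = block_length (r n)"
    have r1: "r n \<ge> 1" and rZ: "2 * A * (real Z + 1) \<le> r n" using elim by auto
    have L: "real L \<le> 2 * (r n)\<^sup>2" "L > 0" using block_length_bounds[OF r1] by (simp_all add: L_def)
    have "A * (real Z * real L) \<le> A * ((real Z + 1) * (2 * (r n)\<^sup>2))"
      using L A by (intro mult_left_mono mult_mono) auto
    also have "\<dots> = (2 * A * (real Z + 1)) * (r n)\<^sup>2" by simp
    also have "\<dots> \<le> r n * (r n)\<^sup>2" using rZ by (intro mult_right_mono) auto
    also have "\<dots> = r n ^ 3" by (simp add: power2_eq_square power3_eq_cube)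
    also have "\<dots> \<le> A * real n" using n elim by blast
    finally have "real (Z * L) \<le> real n" using A by simp
    then have "Z * L \<le> n" by (simp only: of_nat_le_iff)
    then show ?case using L unfolding L_def[symmetric] by (simp add: less_eq_div_iff_mult_less_eq)
  qed
qed

theorem proposition1p3:
  fixes M :: "'w measure"
    and S :: "nat \<Rightarrow> 'w \<Rightarrow> int ^ 3"
    and r :: "nat \<Rightarrow> real"
  assumes "simple_random_walk M S"
    and "\<And>n. n \<ge> 1 \<Longrightarrow> r n > 0"
    and "filterlim r at_top sequentially"
    and "\<exists>A>0. \<forall>n\<ge>1. r n ^ 3 \<le> A * real n"
  shows "\<exists>\<epsilon>>0. \<exists>\<delta>>0. \<forall>\<epsilon>\<^sub>0 \<delta>\<^sub>0. 0 < \<epsilon>\<^sub>0 \<and> \<epsilon>\<^sub>0 < \<epsilon> \<and> 0 < \<delta>\<^sub>0 \<and> \<delta>\<^sub>0 < \<delta> \<longrightarrow>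
    (\<lambda>n. \<P>(\<omega> in M.
        real (card {x. real (local_time S n x \<omega>)
                       > \<delta>\<^sub>0 * (real n / real (card (lattice_ball (r n) :: (int ^ 3) set)))})
          \<ge> \<epsilon>\<^sub>0 * real (card (lattice_ball (r n) :: (int ^ 3) set))
        \<bar> exit_time S (r n) \<omega> > enat n)) \<longlonglongrightarrow> (1::real)"
proof -
  obtain A where A: "A > 0" "\<forall>n\<ge>1. r n ^ 3 \<le> A * real n" using assms(4) by blast
  obtain m :: nat where m': "real m > 128 * return_constant * exp 144" using reals_Archimedean2 by blast
  have "0 \<le> 128 * return_constant * exp 144" by (simp add: return_constant_nonneg)
  then have "real m > 0" using m' by linarith
  then have m: "m > 0" by simp
  have "64 * return_constant / real m \<le> exp (- 144) / 2"
    using m' m by (simp add: exp_minus field_simps)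
  define \<epsilon> where "\<epsilon> = min ((exp (- 144) / 32) ^ 3 / 27) (1 / (16 * 27 * A * real m))"
  define N where "N n = n div block_length (r n)" for n
  have N: "filterlim N at_top sequentially"
    unfolding N_def using assms(3) A by (intro block_count_at_top)
  have \<epsilon>_pos: "\<epsilon> > 0" using A m by (simp add: \<epsilon>_def)
  have limit: "(\<lambda>n. \<P>(\<omega> in M.
        real (card {x. real (local_time S n x \<omega>)
                       > \<delta>\<^sub>0 * (real n / real (card (lattice_ball (r n) :: (int ^ 3) set)))})
          \<ge> \<epsilon>\<^sub>0 * real (card (lattice_ball (r n) :: (int ^ 3) set))
        \<bar> exit_time S (r n) \<omega> > enat n)) \<longlonglongrightarrow> (1::real)"
    if \<epsilon>\<^sub>0: "0 < \<epsilon>\<^sub>0" "\<epsilon>\<^sub>0 < \<epsilon>" and \<delta>\<^sub>0: "0 < \<delta>\<^sub>0" "\<delta>\<^sub>0 < 1 / 16" for \<epsilon>\<^sub>0 \<delta>\<^sub>0 :: real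
  proof (rule tendsto_sandwich)
    have small1: "27 * \<epsilon>\<^sub>0 \<le> (exp (- 144) / 32) ^ 3" using \<epsilon>\<^sub>0 by (simp add: \<epsilon>_def)
    have "\<epsilon>\<^sub>0 * (16 * 27 * A * real m) \<le> 1"
      using \<epsilon>\<^sub>0 A m by (simp add: \<epsilon>_def less_divide_eq less_imp_le)
    then have small2: "27 * \<epsilon>\<^sub>0 * A * real m \<le> 1 / 16" by (simp add: algebra_simps)
    have "eventually (\<lambda>n. 4 \<le> r n) sequentially" using assms(3) by (simp add: filterlim_at_top)
    moreover have "eventually (\<lambda>n. 1 \<le> N n) sequentially" using N by (simp add: filterlim_at_top)
    ultimately have ev: "eventually (\<lambda>n. n \<ge> 1 \<and> 4 \<le> r n \<and> 1 \<le> N n) sequentially"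
      using eventually_ge_at_top[of 1] by eventually_elim simp
    note bound = cond_prob_heavy_ge[OF assms(1) _ _ A(1) m \<open>64 * return_constant / real m \<le> exp (- 144) / 2\<close>
        \<epsilon>\<^sub>0(1) small1 small2 \<delta>\<^sub>0(1) less_imp_le[OF \<delta>\<^sub>0(2)] N_def]
    show "eventually (\<lambda>n. 1 - exp 32 * (2 / 5) ^ N n \<le> \<P>(\<omega> in M.
        real (card {x. real (local_time S n x \<omega>)
                       > \<delta>\<^sub>0 * (real n / real (card (lattice_ball (r n) :: (int ^ 3) set)))})
          \<ge> \<epsilon>\<^sub>0 * real (card (lattice_ball (r n) :: (int ^ 3) set))
        \<bar> exit_time S (r n) \<omega> > enat n)) sequentially"
      using ev by (rule eventually_mono) (use bound(1) A(2) in auto)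
    show "eventually (\<lambda>n. \<P>(\<omega> in M.
        real (card {x. real (local_time S n x \<omega>)
                       > \<delta>\<^sub>0 * (real n / real (card (lattice_ball (r n) :: (int ^ 3) set)))})
          \<ge> \<epsilon>\<^sub>0 * real (card (lattice_ball (r n) :: (int ^ 3) set))
        \<bar> exit_time S (r n) \<omega> > enat n) \<le> 1) sequentially"
      using ev by (rule eventually_mono) (use bound(2) A(2) in auto)
    have "(\<lambda>n. (2 / 5 :: real) ^ N n) \<longlonglongrightarrow> 0"
      using filterlim_compose[OF LIMSEQ_power_zero[of "2 / 5 :: real"] N] by simp
    then show "(\<lambda>n. 1 - exp 32 * (2 / 5) ^ N n) \<longlonglongrightarrow> (1 :: real)"
      by (auto intro!: tendsto_eq_intros)
  qed simp
  show ?thesis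
  proof (rule exI[of _ \<epsilon>], rule conjI[OF \<epsilon>_pos], rule exI[of _ "1 / 16"], rule conjI)
    show "0 < (1 / 16 :: real)" by simp
  qed (use limit in blast)
qed

end
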